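(* Total continuous machines form a subalgebra $\mathsf{Mch}^{\mathrm{t}}\colon\mathcal{W}_{\widetilde{\mathrm{Int}}}\to\mathbf{Cat}$ of the algebra $\mathsf{Mch}$ of continuous machines. Similarly, deterministic continuous machines form a subalgebra $\mathsf{Mch}^{\mathrm{d}}\colon\mathcal{W}_{\widetilde{\mathrm{Int}}}\to\mathbf{Cat}$. Their intersection is a subalgebra $\mathsf{Mch}^{\mathrm{td}}=\mathsf{Mch}^{\mathrm{t}}\cap\mathsf{Mch}^{\mathrm{d}}$.
   Context: Interval sheaves. $\mathrm{Int}$ is the category with objects $\ell\in\mathbb{R}_{\ge0}$, morphisms $\ell'\to\ell$ the symbols $\mathrm{Tr}_p$ with $p\in\mathbb{R}_{\ge0}$, $p\le\ell-\ell'$, composition $\mathrm{Tr}_p\circ\mathrm{Tr}_{p'}=\mathrm{Tr}_{p+p'}$, identities $\mathrm{Tr}_0$. For a presheaf $X$ and $x\in X(\ell)$, write $x|_{[p,p+\ell']}=X(\mathrm{Tr}_p)(x)$. A continuous interval sheaf is a presheaf $X$ on $\mathrm{Int}$ such that for all $x_1\in X(\ell_1)$, $x_2\in X(\ell_2)$ with $x_1|_{[\ell_1,\ell_1]}=x_2|_{[0,0]}$ there is a unique element of $X(\ell_1+\ell_2)$ restricting to $x_1$ on $[0,\ell_1]$ and to $x_2$ on $[\ell_1,\ell_1+\ell_2]$. $\widetilde{\mathrm{Int}}$ is the topos of such sheaves. For $\epsilon\ge0$, $(\mathsf{Ext}_\epsilon A)(\ell)=A(\ell+\epsilon)$ defines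 $\mathsf{Ext}_\epsilon\colon\widetilde{\mathrm{Int}}\to\widetilde{\mathrm{Int}}$, and $\lambda\colon\mathsf{Ext}_\epsilon\Rightarrow\mathrm{id}$ is left restriction $x\mapsto x|_{[0,\ell]}$. Machines. A continuous $(A,B)$-machine is a sheaf map $(p^i,p^o)\colon S\to A\times B$. A sheaf map $p\colon S\to A$ is total (resp. deterministic) if for all $\epsilon>0$ the induced map $h^\epsilon\colon\mathsf{Ext}_\epsilon S\to\mathsf{Ext}_\epsilon A\times_AS$ (pullback of $\lambda_A$ and $p$; $h^\epsilon$ induced by $\mathsf{Ext}_\epsilon p$ and $\lambda_S$) is an epimorphism (resp. monomorphism) in $\widetilde{\mathrm{Int}}$; equivalently, for all $\epsilon>0$ the function $S(\epsilon)\to\{(a,s_0)\in A(\epsilon)\times S(0)\mid a|_{[0,0]}=p(s_0)\}$, $s\mapsto(p(s),s|_{[0,0]})$, is surjective (resp. injective). A sheaf map $p\colon S\to B$ is inertial if for some $\epsilon>0$ it factors as $S\to\mathsf{Ext}_\epsilon B\xrightarrow{\lambda}B$ in $\widetilde{\mathrm{Int}}$. A machine $(p^i,p^o)$ is total (resp. deterministic) if $p^i$ is total (resp. deterministic) and $p^o$ is inertial. Wiring diagrams, with $\mathcal{C}=\widetilde{\mathrm{Int}}$. A $\mathcal{C}$-typed finite set is a finite set $X$ with $\tau\colon X\to\mathrm{ob}\,\mathcal{C}$; typed functions preserve types; $\widehat{X}=\prod_{x\in X}\tau(x)$; a typed function $f\colon X\to X'$ induces $\widehat{f}\colon\widehat{X'}\to\widehat{X}$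 by reindexing. $\mathcal{W}_{\mathcal{C}}$ is the symmetric monoidal category whose objects (boxes) are pairs $X=(X^{\mathrm{in}},X^{\mathrm{out}})$ of $\mathcal{C}$-typed finite sets and whose morphisms (wiring diagrams) $\phi\colon X\to Y$ are pairs of typed functions $\phi^{\mathrm{in}}\colon X^{\mathrm{in}}\to X^{\mathrm{out}}+Y^{\mathrm{in}}$, $\phi^{\mathrm{out}}\colon Y^{\mathrm{out}}\to X^{\mathrm{out}}$. The composite $\omega=\psi\circ\phi$ has $\omega^{\mathrm{out}}=\phi^{\mathrm{out}}\circ\psi^{\mathrm{out}}$ and $\omega^{\mathrm{in}}=(\nabla+1)\circ(1+\phi^{\mathrm{out}}+1)\circ(1+\psi^{\mathrm{in}})\circ\phi^{\mathrm{in}}$; the identity is (coproduct inclusion, identity). The tensor $\oplus$ is componentwise disjoint union with unit $0=(\emptyset,\emptyset)$. $\phi$ induces $\widehat{\phi^{\mathrm{in}}}\colon\widehat{Y^{\mathrm{in}}}\times\widehat{X^{\mathrm{out}}}\to\widehat{X^{\mathrm{in}}}$ and $\widehat{\phi^{\mathrm{out}}}\colon\widehat{X^{\mathrm{out}}}\to\widehat{Y^{\mathrm{out}}}$. A $\mathcal{W}_{\mathcal{C}}$-algebra is a symmetric lax monoidal functor $(\mathcal{W}_{\mathcal{C}},\oplus,0)\to(\mathbf{Cat},\times,\mathbf{1})$, in the pseudo sense (axioms up to coherent natural isomorphism). The algebra $\mathsf{Mch}$ has $\mathsf{Mch}(X)=\widetilde{\mathrm{Int}}/(\widehat{X^{\mathrm{in}}}\times\widehat{X^{\mathrm{out}}})$;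 $\mathsf{Mch}(\phi)$ pulls a machine back along $(\widehat{\phi^{\mathrm{in}}},\pi_2)\colon\widehat{Y^{\mathrm{in}}}\times\widehat{X^{\mathrm{out}}}\to\widehat{X^{\mathrm{in}}}\times\widehat{X^{\mathrm{out}}}$ and postcomposes with $1\times\widehat{\phi^{\mathrm{out}}}$; the lax structure is cartesian product of spans. A class of machines forms a subalgebra if the corresponding full subcategories of $\mathsf{Mch}(X)$ are preserved by all $\mathsf{Mch}(\phi)$ and by the lax monoidal structure maps (including the unit). *)

theory Defs
  imports Complex_Main "HOL-Library.FuncSet"
begin

section \<open>Continuous interval sheaves\<close>

text \<open>
  \<open>sec X l\<close> is the set \<open>X(l)\<close>, and \<open>restr X l p l' x\<close> is \<open>X(Tr_p)(x)\<close>, the restriction of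
  \<open>x \<in> X(l)\<close> to \<open>[p, p + l']\<close>, for the morphism \<open>Tr_p : l' \<rightarrow> l\<close> of Int. The source length \<open>l\<close>
  is an argument because the sets \<open>X(l)\<close> need not be disjoint. Values at negative lengths, or
  for \<open>p\<close> outside \<open>0 \<le> p \<le> l - l'\<close>, are irrelevant.
\<close>

record 'a presheaf =
  sec :: "real \<Rightarrow> 'a set"
  restr :: "real \<Rightarrow> real \<Rightarrow> real \<Rightarrow> 'a \<Rightarrow> 'a"

definition int_hom :: "real \<Rightarrow> real \<Rightarrow> real \<Rightarrow> bool" where
  "int_hom l' l p \<longleftrightarrow> 0 \<le> l' \<and> 0 \<le> l \<and> 0 \<le> p \<and> p \<le> l - l'"

definition presheaf :: "'a presheaf \<Rightarrow> bool" where
  "presheaf X \<longleftrightarrow>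
     (\<forall>l p l' x. int_hom l' l p \<longrightarrow> x \<in> sec X l \<longrightarrow> restr X l p l' x \<in> sec X l') \<and>
     (\<forall>l x. 0 \<le> l \<longrightarrow> x \<in> sec X l \<longrightarrow> restr X l 0 l x = x) \<and>
     (\<forall>l p l' p' l'' x. int_hom l' l p \<longrightarrow> int_hom l'' l' p' \<longrightarrow> x \<in> sec X l \<longrightarrow>
        restr X l' p' l'' (restr X l p l' x) = restr X l (p + p') l'' x)"

definition sheaf :: "'a presheaf \<Rightarrow> bool" where
  "sheaf X \<longleftrightarrow> presheaf X \<and>
     (\<forall>l1 l2 x1 x2. 0 \<le> l1 \<longrightarrow> 0 \<le> l2 \<longrightarrow> x1 \<in> sec X l1 \<longrightarrow> x2 \<in> sec X l2 \<longrightarrow>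
        restr X l1 l1 0 x1 = restr X l2 0 0 x2 \<longrightarrow>
        (\<exists>!x. x \<in> sec X (l1 + l2) \<and>
           restr X (l1 + l2) 0 l1 x = x1 \<and> restr X (l1 + l2) l1 l2 x = x2))"

definition sheaf_map :: "'a presheaf \<Rightarrow> 'b presheaf \<Rightarrow> (real \<Rightarrow> 'a \<Rightarrow> 'b) \<Rightarrow> bool" where
  "sheaf_map A B f \<longleftrightarrow>
     (\<forall>l x. 0 \<le> l \<longrightarrow> x \<in> sec A l \<longrightarrow> f l x \<in> sec B l) \<and>
     (\<forall>l p l' x. int_hom l' l p \<longrightarrow> x \<in> sec A l \<longrightarrow>
        f l' (restr A l p l' x) = restr B l p l' (f l x))"

definition map_eq :: "'a presheaf \<Rightarrow> (real \<Rightarrow> 'a \<Rightarrow> 'b) \<Rightarrow> (real \<Rightarrow> 'a \<Rightarrow> 'b) \<Rightarrow> bool" where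
  "map_eq A f g \<longleftrightarrow> (\<forall>l x. 0 \<le> l \<longrightarrow> x \<in> sec A l \<longrightarrow> f l x = g l x)"

definition comp_map :: "(real \<Rightarrow> 'b \<Rightarrow> 'c) \<Rightarrow> (real \<Rightarrow> 'a \<Rightarrow> 'b) \<Rightarrow> real \<Rightarrow> 'a \<Rightarrow> 'c" where
  "comp_map g f = (\<lambda>l x. g l (f l x))"

definition Ext :: "real \<Rightarrow> 'a presheaf \<Rightarrow> 'a presheaf" where
  "Ext e A = \<lparr> sec = (\<lambda>l. sec A (l + e)),
               restr = (\<lambda>l p l' x. restr A (l + e) p (l' + e) x) \<rparr>"

definition Ext_map :: "real \<Rightarrow> (real \<Rightarrow> 'a \<Rightarrow> 'b) \<Rightarrow> real \<Rightarrow> 'a \<Rightarrow> 'b" where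
  "Ext_map e f = (\<lambda>l x. f (l + e) x)"

definition left_restr :: "real \<Rightarrow> 'a presheaf \<Rightarrow> real \<Rightarrow> 'a \<Rightarrow> 'a" where
  "left_restr e A = (\<lambda>l x. restr A (l + e) 0 l x)"

definition sheaf_prod :: "'a presheaf \<Rightarrow> 'b presheaf \<Rightarrow> ('a \<times> 'b) presheaf" where
  "sheaf_prod A B = \<lparr> sec = (\<lambda>l. sec A l \<times> sec B l),
                      restr = (\<lambda>l p l' (x, y). (restr A l p l' x, restr B l p l' y)) \<rparr>"

definition pullback ::
  "'a presheaf \<Rightarrow> (real \<Rightarrow> 'a \<Rightarrow> 'c) \<Rightarrow> 'b presheaf \<Rightarrow> (real \<Rightarrow> 'b \<Rightarrow> 'c) \<Rightarrow> ('a \<times> 'b) presheaf" where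
  "pullback A f B g =
     \<lparr> sec = (\<lambda>l. {(x, y). x \<in> sec A l \<and> y \<in> sec B l \<and> f l x = g l y}),
       restr = (\<lambda>l p l' (x, y). (restr A l p l' x, restr B l p l' y)) \<rparr>"

definition terminal_sheaf :: "unit presheaf" where
  "terminal_sheaf = \<lparr> sec = (\<lambda>l. {()}), restr = (\<lambda>l p l' x. ()) \<rparr>"


section \<open>Monomorphisms and epimorphisms of sheaves\<close>

text \<open>
  A HOL definition cannot quantify over types, so cancellability is required against all sheaves
  with values in one fixed type. That type is large enough for both notions: it contains the
  values of the representable sheaves and of the subobject classifier. The lemmas
  \<open>sheaf_mono_cancel\<close> and \<open>sheaf_epi_cancel\<close> derive cancellability against sheaves with values
  in an arbitrary type.
\<close>

type_synonym probe = "(real \<times> real) set"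

definition sheaf_mono :: "'a presheaf \<Rightarrow> 'b presheaf \<Rightarrow> (real \<Rightarrow> 'a \<Rightarrow> 'b) \<Rightarrow> bool" where
  "sheaf_mono A B f \<longleftrightarrow> sheaf_map A B f \<and>
     (\<forall>(Z :: probe presheaf) g g'. sheaf Z \<longrightarrow> sheaf_map Z A g \<longrightarrow> sheaf_map Z A g' \<longrightarrow>
        map_eq Z (comp_map f g) (comp_map f g') \<longrightarrow> map_eq Z g g')"

definition sheaf_epi :: "'a presheaf \<Rightarrow> 'b presheaf \<Rightarrow> (real \<Rightarrow> 'a \<Rightarrow> 'b) \<Rightarrow> bool" where
  "sheaf_epi A B f \<longleftrightarrow> sheaf_map A B f \<and>
     (\<forall>(Z :: probe presheaf) g g'. sheaf Z \<longrightarrow> sheaf_map B Z g \<longrightarrow> sheaf_map B Z g' \<longrightarrow>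
        map_eq A (comp_map g f) (comp_map g' f) \<longrightarrow> map_eq B g g')"

text \<open>The sheaf represented by \<open>l\<close>; the morphism \<open>Tr_p : m \<rightarrow> l\<close> is encoded as \<open>{(p, m)}\<close>.\<close>

definition representable :: "real \<Rightarrow> probe presheaf" where
  "representable l = \<lparr> sec = (\<lambda>m. {{(p, m)} |p. int_hom m l p}),
                       restr = (\<lambda>m q m' z. {(fst (the_elem z) + q, m')}) \<rparr>"

lemma presheafD:
  assumes "presheaf X"
  shows "int_hom l' l p \<Longrightarrow> x \<in> sec X l \<Longrightarrow> restr X l p l' x \<in> sec X l'"
    and "0 \<le> l \<Longrightarrow> x \<in> sec X l \<Longrightarrow> restr X l 0 l x = x"
    and "int_hom l' l p \<Longrightarrow> int_hom l'' l' p' \<Longrightarrow> x \<in> sec X l \<Longrightarrow>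
        restr X l' p' l'' (restr X l p l' x) = restr X l (p + p') l'' x"
  using assms unfolding presheaf_def by blast+

lemma sheaf_representable: "sheaf (representable l)"
proof -
  have "presheaf (representable l)"
    unfolding presheaf_def representable_def int_hom_def by (auto simp: algebra_simps)
  moreover have "\<exists>!x. x \<in> sec (representable l) (l1 + l2) \<and>
       restr (representable l) (l1 + l2) 0 l1 x = x1 \<and> restr (representable l) (l1 + l2) l1 l2 x = x2"
    if "0 \<le> l1" "0 \<le> l2" "x1 \<in> sec (representable l) l1" "x2 \<in> sec (representable l) l2"
      "restr (representable l) l1 l1 0 x1 = restr (representable l) l2 0 0 x2" for l1 l2 x1 x2
  proof -
    from that obtain p q where pq: "x1 = {(p, l1)}" "x2 = {(q, l2)}" "int_hom l1 l p" "int_hom l2 l q"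
      by (auto simp: representable_def)
    with that have "q = p + l1" by (auto simp: representable_def)
    with pq show ?thesis
      by (intro ex1I[of _ "{(p, l1 + l2)}"]) (auto simp: representable_def int_hom_def)
  qed
  ultimately show ?thesis unfolding sheaf_def by blast
qed

lemma sheaf_mono_inj:
  assumes A: "sheaf A" and f: "sheaf_mono A B f" and l: "0 \<le> l"
    and x: "x \<in> sec A l" and y: "y \<in> sec A l" and eq: "f l x = f l y"
  shows "x = y"
proof -
  define g where "g z = (\<lambda>m (q :: probe). restr A l (fst (the_elem q)) m z)" for z
  have pA: "presheaf A" using A by (simp add: sheaf_def)
  have fm: "sheaf_map A B f" using f by (simp add: sheaf_mono_def)
  have g: "sheaf_map (representable l) A (g z)" if "z \<in> sec A l" for z
    unfolding sheaf_map_def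
  proof (intro conjI allI impI)
    fix m q assume "0 \<le> m" "q \<in> sec (representable l) m"
    then show "g z m q \<in> sec A m"
      using presheafD(1)[OF pA _ that] by (auto simp: representable_def g_def)
  next
    fix m p m' q assume "int_hom m' m p" "q \<in> sec (representable l) m"
    then show "g z m' (restr (representable l) m p m' q) = restr A m p m' (g z m q)"
      using presheafD(3)[OF pA _ _ that] by (auto simp: representable_def g_def)
  qed
  have "map_eq (representable l) (comp_map f (g x)) (comp_map f (g y))"
    unfolding map_eq_def comp_map_def
  proof (intro allI impI)
    fix m q assume "0 \<le> m" "q \<in> sec (representable l) m"
    then obtain p where p: "q = {(p, m)}" "int_hom m l p" by (auto simp: representable_def)
    have "f m (restr A l p m x) = f m (restr A l p m y)"
      using fm p(2) x y eq unfolding sheaf_map_def by metis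
    then show "f m (g x m q) = f m (g y m q)" by (simp add: g_def p)
  qed
  then have e: "map_eq (representable l) (g x) (g y)"
    using f sheaf_representable g[OF x] g[OF y] unfolding sheaf_mono_def by blast
  have "{(0, l)} \<in> sec (representable l) l" using l by (auto simp: representable_def int_hom_def)
  then have "g x l {(0, l)} = g y l {(0, l)}" using e l unfolding map_eq_def by blast
  then show ?thesis using presheafD(2)[OF pA l] x y by (simp add: g_def)
qed

lemma sheaf_mono_cancel:
  fixes Z :: "'z presheaf"
  assumes "sheaf A" "sheaf_mono A B f" "sheaf_map Z A g" "sheaf_map Z A g'"
    and "map_eq Z (comp_map f g) (comp_map f g')"
  shows "map_eq Z g g'"
  using sheaf_mono_inj[OF assms(1,2)] assms(3-5)
  unfolding map_eq_def comp_map_def sheaf_map_def by blast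

text \<open>The subobject classifier: \<open>(p, m) \<in> C\<close> says that the closed sieve \<open>C\<close> contains
  \<open>Tr_p : m \<rightarrow> l\<close>.\<close>

definition classifier :: "probe presheaf" where
  "classifier = \<lparr>
     sec = (\<lambda>l. {C. (\<forall>p m. (p, m) \<in> C \<longrightarrow> int_hom m l p) \<and>
        (\<forall>p m q k. (p, m) \<in> C \<longrightarrow> int_hom k m q \<longrightarrow> (p + q, k) \<in> C) \<and>
        (\<forall>p m k. (p, m) \<in> C \<longrightarrow> (p + m, k) \<in> C \<longrightarrow> (p, m + k) \<in> C)}),
     restr = (\<lambda>l p l' C. {(q, m). int_hom m l' q \<and> (p + q, m) \<in> C}) \<rparr>"

lemma classifierD:
  assumes "C \<in> sec classifier l"
  shows "(p, m) \<in> C \<Longrightarrow> int_hom m l p"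
    and "(p, m) \<in> C \<Longrightarrow> int_hom k m q \<Longrightarrow> (p + q, k) \<in> C"
    and "(p, m) \<in> C \<Longrightarrow> (p + m, k) \<in> C \<Longrightarrow> (p, m + k) \<in> C"
    and "(p, m) \<in> C \<Longrightarrow> p \<le> q \<Longrightarrow> 0 \<le> k \<Longrightarrow> q + k \<le> p + m \<Longrightarrow> (q, k) \<in> C"
proof -
  show 2: "(p + q, k) \<in> C" if "(p, m) \<in> C" "int_hom k m q" for p m k q
    using assms that unfolding classifier_def by auto
  show "(p, m) \<in> C \<Longrightarrow> int_hom m l p"
    and "(p, m) \<in> C \<Longrightarrow> (p + m, k) \<in> C \<Longrightarrow> (p, m + k) \<in> C"
    using assms unfolding classifier_def by auto
  show "(q, k) \<in> C" if "(p, m) \<in> C" "p \<le> q" "0 \<le> k" "q + k \<le> p + m"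
    using 2[of p m k "q - p"] that by (simp add: int_hom_def)
qed

lemma presheaf_classifier: "presheaf classifier"
  unfolding presheaf_def
proof (intro conjI allI impI)
  fix l p l' and C :: probe
  assume h: "int_hom l' l p" and C: "C \<in> sec classifier l"
  have "(a + q, k) \<in> restr classifier l p l' C"
    if "(a, m) \<in> restr classifier l p l' C" "int_hom k m q" for a m k q
  proof -
    have "(p + a, m) \<in> C" and i: "int_hom m l' a" using that(1) by (auto simp: classifier_def)
    from classifierD(2)[OF C this(1) that(2)] i that(2) show ?thesis
      by (auto simp: classifier_def int_hom_def algebra_simps)
  qed
  moreover have "(a, m + k) \<in> restr classifier l p l' C"
    if "(a, m) \<in> restr classifier l p l' C" "(a + m, k) \<in> restr classifier l p l' C" for a m k
    using that classifierD(3)[OF C, of "p + a" m k]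
    by (auto simp: classifier_def int_hom_def algebra_simps)
  moreover have "int_hom m l' a" if "(a, m) \<in> restr classifier l p l' C" for a m
    using that by (auto simp: classifier_def)
  ultimately show "restr classifier l p l' C \<in> sec classifier l'"
    by (subst classifier_def) simp
next
  fix l and C :: probe
  assume "0 \<le> l" "C \<in> sec classifier l"
  then show "restr classifier l 0 l C = C" by (auto simp: classifier_def)
next
  fix l p l' p' l'' and C :: probe
  assume "int_hom l' l p" "int_hom l'' l' p'" "C \<in> sec classifier l"
  then show "restr classifier l' p' l'' (restr classifier l p l' C) = restr classifier l (p + p') l'' C"
    by (auto simp: classifier_def int_hom_def algebra_simps)
qed

lemma sheaf_classifier: "sheaf classifier"
proof -
  have "\<exists>!x. x \<in> sec classifier (l1 + l2) \<and>
       restr classifier (l1 + l2) 0 l1 x = C1 \<and> restr classifier (l1 + l2) l1 l2 x = C2"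
    if l: "0 \<le> l1" "0 \<le> l2" and C1: "C1 \<in> sec classifier l1" and C2: "C2 \<in> sec classifier l2"
      and eq: "restr classifier l1 l1 0 C1 = restr classifier l2 0 0 C2" for l1 l2 C1 C2
  proof -
    note C1D = classifierD[OF C1] and C2D = classifierD[OF C2]
    have restr_iff: "(q, m) \<in> restr classifier k p k' D \<longleftrightarrow> int_hom m k' q \<and> (p + q, m) \<in> D"
      for q m k p k' D by (simp add: classifier_def)
    have "(0, 0) \<in> restr classifier l1 l1 0 C1 \<longleftrightarrow> (0, 0) \<in> restr classifier l2 0 0 C2"
      using eq by simp
    then have mid: "(l1, 0) \<in> C1 \<longleftrightarrow> (0, 0) \<in> C2"
      by (simp add: restr_iff int_hom_def)
    define C where "C = {(q, m). int_hom m (l1 + l2) q \<and>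
       (q \<le> l1 \<longrightarrow> (q, min m (l1 - q)) \<in> C1) \<and>
       (l1 \<le> q + m \<longrightarrow> (max 0 (q - l1), q + m - max l1 q) \<in> C2)}"
    have Ciff: "(q, m) \<in> C \<longleftrightarrow> int_hom m (l1 + l2) q \<and>
       (q \<le> l1 \<longrightarrow> (q, min m (l1 - q)) \<in> C1) \<and>
       (l1 \<le> q + m \<longrightarrow> (max 0 (q - l1), q + m - max l1 q) \<in> C2)" for q m by (simp add: C_def)
    have 2: "(p + q, k) \<in> C" if C: "(p, m) \<in> C" and h: "int_hom k m q" for p m q k
    proof -
      have "(p + q, min k (l1 - (p + q))) \<in> C1" if "p + q \<le> l1"
      proof (rule C1D(4)[of p "min m (l1 - p)"])
        show "(p, min m (l1 - p)) \<in> C1" using that C h by (simp add: Ciff int_hom_def)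
      qed (use that h in \<open>auto simp: int_hom_def\<close>)
      moreover have "(max 0 (p + q - l1), p + q + k - max l1 (p + q)) \<in> C2" if "l1 \<le> p + q + k"
      proof (rule C2D(4)[of "max 0 (p - l1)" "p + m - max l1 p"])
        show "(max 0 (p - l1), p + m - max l1 p) \<in> C2" using that C h by (simp add: Ciff int_hom_def)
      qed (use that h in \<open>auto simp: int_hom_def\<close>)
      moreover have "int_hom k (l1 + l2) (p + q)" using C h by (simp add: Ciff int_hom_def)
      ultimately show ?thesis by (simp add: Ciff)
    qed
    have 3: "(p, m + k) \<in> C" if C: "(p, m) \<in> C" "(p + m, k) \<in> C" for p m k
    proof -
      have h: "int_hom m (l1 + l2) p" "int_hom k (l1 + l2) (p + m)" using C by (auto simp: Ciff)
      have "(p, min (m + k) (l1 - p)) \<in> C1" if "p \<le> l1"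
      proof (cases "p + m \<le> l1")
        case True
        then have "(p, m) \<in> C1" "(p + m, min k (l1 - (p + m))) \<in> C1"
          using C that by (auto simp: Ciff min_def split: if_splits)
        from C1D(3)[OF this] show ?thesis by (simp add: min_add_distrib_right algebra_simps)
      next
        case False
        then have "min (m + k) (l1 - p) = l1 - p" "min m (l1 - p) = l1 - p"
          using h by (auto simp: int_hom_def)
        then show ?thesis using C(1) that by (auto simp: Ciff)
      qed
      moreover have "(max 0 (p - l1), p + (m + k) - max l1 p) \<in> C2" if "l1 \<le> p + (m + k)"
      proof (cases "l1 \<le> p + m")
        case True
        then have "(max 0 (p - l1), p + m - max l1 p) \<in> C2" "(p + m - l1, k) \<in> C2"
          using C that h by (auto simp: Ciff int_hom_def max_def split: if_splits)
        moreover have "max 0 (p - l1) + (p + m - max l1 p) = p + m - l1" by (simp add: max_def)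
        ultimately have "(max 0 (p - l1), (p + m - max l1 p) + k) \<in> C2" by (metis C2D(3))
        then show ?thesis by (simp add: algebra_simps)
      next
        case False
        then have "max 0 (p - l1) = 0" "max l1 p = l1" "max 0 (p + m - l1) = 0" "max l1 (p + m) = l1"
          using h by (auto simp: int_hom_def)
        then show ?thesis using C(2) that by (auto simp: Ciff add.assoc)
      qed
      moreover have "int_hom (m + k) (l1 + l2) p" using h by (simp add: int_hom_def)
      ultimately show ?thesis by (simp add: Ciff)
    qed
    have "\<forall>p m. (p, m) \<in> C \<longrightarrow> int_hom m (l1 + l2) p" by (simp add: Ciff)
    then have mem: "C \<in> sec classifier (l1 + l2)"
      using 2 3 by (simp add: classifier_def)
    have r1: "restr classifier (l1 + l2) 0 l1 C = C1"
    proof (intro set_eqI, clarify)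
      fix q m
      have "(q, m) \<in> C" if q: "(q, m) \<in> C1"
      proof -
        have h: "int_hom m l1 q" using C1D(1)[OF q] .
        have "(0, 0) \<in> C2" if "l1 \<le> q + m"
          using C1D(4)[OF q, of l1 0] h that mid by (auto simp: int_hom_def)
        moreover have "max 0 (q - l1) = 0" "min m (l1 - q) = m" "int_hom m (l1 + l2) q"
          "l1 \<le> q + m \<Longrightarrow> q + m - max l1 q = 0"
          using h l by (auto simp: int_hom_def)
        ultimately show ?thesis using q unfolding Ciff by metis
      qed
      moreover have "(q, m) \<in> C1" if "(q, m) \<in> C" "int_hom m l1 q"
        using that by (auto simp: Ciff int_hom_def min_def split: if_splits)
      ultimately show "(q, m) \<in> restr classifier (l1 + l2) 0 l1 C \<longleftrightarrow> (q, m) \<in> C1"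
        using C1D(1) by (auto simp: restr_iff)
    qed
    have r2: "restr classifier (l1 + l2) l1 l2 C = C2"
    proof (intro set_eqI, clarify)
      fix q m
      have "(l1 + q, m) \<in> C" if q: "(q, m) \<in> C2"
      proof -
        have h: "int_hom m l2 q" using C2D(1)[OF q] .
        have "(l1, 0) \<in> C1" if "q = 0"
          using C2D(4)[OF q, of 0 0] h that mid by (auto simp: int_hom_def)
        moreover have "max 0 (l1 + q - l1) = q" "l1 + q + m - max l1 (l1 + q) = m"
          "int_hom m (l1 + l2) (l1 + q)" "l1 + q \<le> l1 \<Longrightarrow> q = 0 \<and> min m (l1 - (l1 + q)) = 0"
          using h l by (auto simp: int_hom_def)
        ultimately show ?thesis using q by (auto simp: Ciff)
      qed
      moreover have "(q, m) \<in> C2" if "(l1 + q, m) \<in> C" "int_hom m l2 q"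
        using that by (auto simp: Ciff int_hom_def max_def split: if_splits)
      ultimately show "(q, m) \<in> restr classifier (l1 + l2) l1 l2 C \<longleftrightarrow> (q, m) \<in> C2"
        using C2D(1) by (auto simp: restr_iff)
    qed
    have un: "D = C" if D: "D \<in> sec classifier (l1 + l2)"
      and D1: "restr classifier (l1 + l2) 0 l1 D = C1"
      and D2: "restr classifier (l1 + l2) l1 l2 D = C2" for D
    proof -
      note DD = classifierD[OF D]
      have C1iff: "(q, m) \<in> C1 \<longleftrightarrow> int_hom m l1 q \<and> (q, m) \<in> D" for q m
        unfolding D1[symmetric] by (simp add: restr_iff)
      have C2iff: "(q, m) \<in> C2 \<longleftrightarrow> int_hom m l2 q \<and> (l1 + q, m) \<in> D" for q m
        unfolding D2[symmetric] by (simp add: restr_iff)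
      have "(q, m) \<in> C" if q: "(q, m) \<in> D" for q m
      proof -
        have h: "int_hom m (l1 + l2) q" using DD(1)[OF q] .
        have "(q, min m (l1 - q)) \<in> C1" if "q \<le> l1"
          unfolding C1iff using h that l by (auto intro!: DD(4)[OF q] simp: int_hom_def)
        moreover have "(max 0 (q - l1), q + m - max l1 q) \<in> C2" if "l1 \<le> q + m"
          unfolding C2iff using h that l by (auto intro!: DD(4)[OF q] simp: int_hom_def max_def)
        ultimately show ?thesis using h by (simp add: Ciff)
      qed
      moreover have "(q, m) \<in> D" if q: "(q, m) \<in> C" for q m
      proof -
        have h: "int_hom m (l1 + l2) q" using q by (simp add: Ciff)
        consider "q + m \<le> l1" | "l1 \<le> q" | "q < l1" "l1 < q + m" by linarith
        then show ?thesis
        proof cases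
          case 1
          then have "q \<le> l1" "min m (l1 - q) = m" using h by (auto simp: int_hom_def)
          then show ?thesis using q by (auto simp: Ciff C1iff)
        next
          case 2
          then have "l1 \<le> q + m" "max 0 (q - l1) = q - l1" "max l1 q = q"
            using h by (auto simp: int_hom_def)
          then show ?thesis using q by (auto simp: Ciff C2iff)
        next
          case 3
          then have "min m (l1 - q) = l1 - q" "max 0 (q - l1) = 0" "max l1 q = l1" by auto
          with 3 q have "(q, l1 - q) \<in> D" "(l1, q + m - l1) \<in> D" by (auto simp: Ciff C1iff C2iff)
          with DD(3)[of q "l1 - q" "q + m - l1"] show ?thesis by simp
        qed
      qed
      ultimately show ?thesis by auto
    qed
    show ?thesis by (rule ex1I[of _ C], intro conjI mem r1 r2) (elim conjE, rule un)
  qed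
  then show ?thesis using presheaf_classifier unfolding sheaf_def by blast
qed

lemma sheaf_epi_cancel:
  fixes B :: "'b presheaf" and Z :: "'z presheaf"
  assumes B: "sheaf B" and f: "sheaf_epi A B f" and Z: "sheaf Z"
    and g: "sheaf_map B Z g" and g': "sheaf_map B Z g'"
    and eq: "map_eq A (comp_map g f) (comp_map g' f)"
  shows "map_eq B g g'"
proof -
  define u where "u = (\<lambda>l b. {(p, m). int_hom m l p \<and>
     g m (restr B l p m b) = g' m (restr B l p m b)})"
  define v :: "real \<Rightarrow> 'b \<Rightarrow> probe" where "v = (\<lambda>l b. {(p, m). int_hom m l p})"
  have pB: "presheaf B" and pZ: "presheaf Z" using B Z by (auto simp: sheaf_def)
  note B1 = presheafD(1)[OF pB] and B2 = presheafD(2)[OF pB] and B3 = presheafD(3)[OF pB]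
  have gn: "g l' (restr B l p l' x) = restr Z l p l' (g l x)"
      "g' l' (restr B l p l' x) = restr Z l p l' (g' l x)"
    if "int_hom l' l p" "x \<in> sec B l" for l p l' x
    using g g' that unfolding sheaf_map_def by blast+
  have gs: "g l x \<in> sec Z l" "g' l x \<in> sec Z l" if "0 \<le> l" "x \<in> sec B l" for l x
    using g g' that unfolding sheaf_map_def by blast+
  have glue: "x = y" if l: "0 \<le> l1" "0 \<le> l2" and x: "x \<in> sec Z (l1 + l2)" and y: "y \<in> sec Z (l1 + l2)"
    and e: "restr Z (l1 + l2) 0 l1 x = restr Z (l1 + l2) 0 l1 y"
      "restr Z (l1 + l2) l1 l2 x = restr Z (l1 + l2) l1 l2 y" for l1 l2 x y
  proof -
    have h: "int_hom l1 (l1 + l2) 0" "int_hom l2 (l1 + l2) l1" "int_hom 0 l1 l1" "int_hom 0 l2 0"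
      using l by (auto simp: int_hom_def)
    have "restr Z l1 l1 0 (restr Z (l1 + l2) 0 l1 x) = restr Z l2 0 0 (restr Z (l1 + l2) l1 l2 x)"
      using presheafD(3)[OF pZ h(1,3) x] presheafD(3)[OF pZ h(2,4) x] by simp
    then have "\<exists>!z. z \<in> sec Z (l1 + l2) \<and>
           restr Z (l1 + l2) 0 l1 z = restr Z (l1 + l2) 0 l1 x \<and>
           restr Z (l1 + l2) l1 l2 z = restr Z (l1 + l2) l1 l2 x"
      using Z l presheafD(1)[OF pZ h(1) x] presheafD(1)[OF pZ h(2) x]
      unfolding sheaf_def by blast
    then show ?thesis using x y e by metis
  qed
  have uiff: "(p, m) \<in> u l b \<longleftrightarrow> int_hom m l p \<and> g m (restr B l p m b) = g' m (restr B l p m b)"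
    for p m l b by (simp add: u_def)
  have u: "sheaf_map B classifier u"
    unfolding sheaf_map_def
  proof (intro conjI allI impI)
    fix l b assume l: "0 \<le> l" and b: "b \<in> sec B l"
    have "(p + q, k) \<in> u l b" if C: "(p, m) \<in> u l b" and h: "int_hom k m q" for p m q k
    proof -
      have i: "int_hom m l p" using C by (simp add: uiff)
      have "g k (restr B m q k (restr B l p m b)) = g' k (restr B m q k (restr B l p m b))"
        using C gn[OF h B1[OF i b]] by (simp add: uiff)
      then show ?thesis using B3[OF i h b] i h by (simp add: uiff int_hom_def)
    qed
    moreover have "(p, m + k) \<in> u l b" if C: "(p, m) \<in> u l b" "(p + m, k) \<in> u l b" for p m k
    proof -
      have i: "int_hom (m + k) l p" "int_hom m (m + k) 0" "int_hom k (m + k) m" "0 \<le> m" "0 \<le> k"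
        using C by (auto simp: uiff int_hom_def)
      define y where "y = restr B l p (m + k) b"
      have y: "y \<in> sec B (m + k)" unfolding y_def by (rule B1[OF i(1) b])
      have "g (m + k) y = g' (m + k) y"
      proof (rule glue)
        show "restr Z (m + k) 0 m (g (m + k) y) = restr Z (m + k) 0 m (g' (m + k) y)"
          using C(1) B3[OF i(1,2) b] unfolding gn[OF i(2) y, symmetric] by (simp add: y_def uiff)
        show "restr Z (m + k) m k (g (m + k) y) = restr Z (m + k) m k (g' (m + k) y)"
          using C(2) B3[OF i(1,3) b] unfolding gn[OF i(3) y, symmetric] by (simp add: y_def uiff)
      qed (use i gs[OF _ y] in auto)
      then show ?thesis using i by (simp add: uiff y_def)
    qed
    moreover have "\<forall>p m. (p, m) \<in> u l b \<longrightarrow> int_hom m l p" by (simp add: uiff)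
    ultimately show "u l b \<in> sec classifier l" by (simp add: classifier_def)
  next
    fix l p l' b assume h: "int_hom l' l p" and b: "b \<in> sec B l"
    show "u l' (restr B l p l' b) = restr classifier l p l' (u l b)"
    proof (intro set_eqI, clarify)
      fix q m
      have "int_hom m l' q \<Longrightarrow> int_hom m l (p + q)" using h by (auto simp: int_hom_def)
      then show "(q, m) \<in> u l' (restr B l p l' b) \<longleftrightarrow> (q, m) \<in> restr classifier l p l' (u l b)"
        using B3[OF h _ b, of m q] by (auto simp: uiff classifier_def)
    qed
  qed
  have v: "sheaf_map B classifier v"
    unfolding sheaf_map_def by (auto simp: v_def classifier_def int_hom_def)
  have fm: "sheaf_map A B f" using f by (simp add: sheaf_epi_def)
  have "map_eq A (comp_map u f) (comp_map v f)"
    unfolding map_eq_def comp_map_def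
  proof (intro allI impI)
    fix l a assume l: "0 \<le> l" and a: "a \<in> sec A l"
    then have b: "f l a \<in> sec B l" using fm unfolding sheaf_map_def by blast
    have e: "g l (f l a) = g' l (f l a)"
      using eq l a unfolding map_eq_def comp_map_def by blast
    show "u l (f l a) = v l (f l a)" using gn[OF _ b] e by (auto simp: u_def v_def)
  qed
  then have uv: "map_eq B u v" using f sheaf_classifier u v unfolding sheaf_epi_def by blast
  show ?thesis unfolding map_eq_def
  proof (intro allI impI)
    fix l b assume l: "0 \<le> l" and b: "b \<in> sec B l"
    have "(0, l) \<in> v l b" using l by (simp add: v_def int_hom_def)
    then have "(0, l) \<in> u l b" using uv l b by (simp add: map_eq_def)
    then show "g l b = g' l b" using B2[OF l b] by (simp add: uiff)
  qed
qed


section \<open>Machines\<close>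

definition total_map :: "'s presheaf \<Rightarrow> 'a presheaf \<Rightarrow> (real \<Rightarrow> 's \<Rightarrow> 'a) \<Rightarrow> bool" where
  "total_map S A p \<longleftrightarrow> (\<forall>e>0.
     sheaf_epi (Ext e S) (pullback (Ext e A) (left_restr e A) S p)
       (\<lambda>l s. (Ext_map e p l s, left_restr e S l s)))"

definition deterministic_map :: "'s presheaf \<Rightarrow> 'a presheaf \<Rightarrow> (real \<Rightarrow> 's \<Rightarrow> 'a) \<Rightarrow> bool" where
  "deterministic_map S A p \<longleftrightarrow> (\<forall>e>0.
     sheaf_mono (Ext e S) (pullback (Ext e A) (left_restr e A) S p)
       (\<lambda>l s. (Ext_map e p l s, left_restr e S l s)))"

definition inertial_map :: "'s presheaf \<Rightarrow> 'b presheaf \<Rightarrow> (real \<Rightarrow> 's \<Rightarrow> 'b) \<Rightarrow> bool" where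
  "inertial_map S B p \<longleftrightarrow> (\<exists>e>0. \<exists>q. sheaf_map S (Ext e B) q \<and>
     map_eq S p (comp_map (left_restr e B) q))"

text \<open>
  An object of the slice over a sheaf \<open>C\<close> is a sheaf \<open>state M\<close> with a map \<open>ports M\<close> to \<open>C\<close>.
  An \<open>(A, B)\<close>-machine is an object of the slice over \<open>A \<times> B\<close>.
\<close>

record ('s, 'c) over =
  state :: "'s presheaf"
  ports :: "real \<Rightarrow> 's \<Rightarrow> 'c"

definition over_obj :: "'c presheaf \<Rightarrow> ('s, 'c) over \<Rightarrow> bool" where
  "over_obj C M \<longleftrightarrow> sheaf (state M) \<and> sheaf_map (state M) C (ports M)"

definition over_hom ::
  "('s, 'c) over \<Rightarrow> ('t, 'c) over \<Rightarrow> (real \<Rightarrow> 's \<Rightarrow> 't) \<Rightarrow> bool" where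
  "over_hom M N f \<longleftrightarrow> sheaf_map (state M) (state N) f \<and>
     map_eq (state M) (comp_map (ports N) f) (ports M)"

definition machine :: "'a presheaf \<Rightarrow> 'b presheaf \<Rightarrow> ('s, 'a \<times> 'b) over \<Rightarrow> bool" where
  "machine A B M \<longleftrightarrow> over_obj (sheaf_prod A B) M"

definition in_port :: "('s, 'a \<times> 'b) over \<Rightarrow> real \<Rightarrow> 's \<Rightarrow> 'a" where
  "in_port M = (\<lambda>l s. fst (ports M l s))"

definition out_port :: "('s, 'a \<times> 'b) over \<Rightarrow> real \<Rightarrow> 's \<Rightarrow> 'b" where
  "out_port M = (\<lambda>l s. snd (ports M l s))"

definition total_machine :: "'a presheaf \<Rightarrow> 'b presheaf \<Rightarrow> ('s, 'a \<times> 'b) over \<Rightarrow> bool" where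
  "total_machine A B M \<longleftrightarrow> machine A B M \<and>
     total_map (state M) A (in_port M) \<and> inertial_map (state M) B (out_port M)"

definition deterministic_machine ::
  "'a presheaf \<Rightarrow> 'b presheaf \<Rightarrow> ('s, 'a \<times> 'b) over \<Rightarrow> bool" where
  "deterministic_machine A B M \<longleftrightarrow> machine A B M \<and>
     deterministic_map (state M) A (in_port M) \<and> inertial_map (state M) B (out_port M)"


section \<open>Boxes and wiring diagrams\<close>

text \<open>
  Wires are labelled by elements of a finite set \<open>wires X\<close> in an arbitrary type. All sheaves on
  wires take values in one type \<open>'a\<close>; this is no restriction, since finitely many value types
  embed into their sum type.
\<close>

record ('i, 'a) typed_set =
  wires :: "'i set"
  wtyp :: "'i \<Rightarrow> 'a presheaf"

definition typed_finite_set :: "('i, 'a) typed_set \<Rightarrow> bool" where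
  "typed_finite_set X \<longleftrightarrow> finite (wires X) \<and> (\<forall>i\<in>wires X. sheaf (wtyp X i))"

definition typed_fun :: "('i, 'a) typed_set \<Rightarrow> ('j, 'a) typed_set \<Rightarrow> ('i \<Rightarrow> 'j) \<Rightarrow> bool" where
  "typed_fun X X' f \<longleftrightarrow> f \<in> wires X \<rightarrow> wires X' \<and> (\<forall>i\<in>wires X. wtyp X' (f i) = wtyp X i)"

definition typed_sum ::
  "('i, 'a) typed_set \<Rightarrow> ('j, 'a) typed_set \<Rightarrow> ('i + 'j, 'a) typed_set" where
  "typed_sum X X' = \<lparr> wires = wires X <+> wires X', wtyp = case_sum (wtyp X) (wtyp X') \<rparr>"

definition typed_empty :: "('i, 'a) typed_set" where
  "typed_empty = \<lparr> wires = {}, wtyp = undefined \<rparr>"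

definition hat :: "('i, 'a) typed_set \<Rightarrow> ('i \<Rightarrow> 'a) presheaf" where
  "hat X = \<lparr> sec = (\<lambda>l. \<Pi>\<^sub>E i\<in>wires X. sec (wtyp X i) l),
             restr = (\<lambda>l p l' x. \<lambda>i\<in>wires X. restr (wtyp X i) l p l' (x i)) \<rparr>"

definition hat_map :: "('i, 'a) typed_set \<Rightarrow> ('i \<Rightarrow> 'j) \<Rightarrow> real \<Rightarrow> ('j \<Rightarrow> 'a) \<Rightarrow> 'i \<Rightarrow> 'a" where
  "hat_map X f = (\<lambda>l x. \<lambda>i\<in>wires X. x (f i))"

text \<open>The canonical isomorphism from \<open>hat X \<times> hat X'\<close> to \<open>hat (typed_sum X X')\<close>.\<close>

definition hat_join ::
  "('i, 'a) typed_set \<Rightarrow> ('j, 'a) typed_set \<Rightarrow> real \<Rightarrow> ('i \<Rightarrow> 'a) \<times> ('j \<Rightarrow> 'a) \<Rightarrow> 'i + 'j \<Rightarrow> 'a" where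
  "hat_join X X' = (\<lambda>l (x, x'). \<lambda>k\<in>wires (typed_sum X X'). case_sum x x' k)"

record ('i, 'o, 'a) box =
  inp :: "('i, 'a) typed_set"
  outp :: "('o, 'a) typed_set"

definition box_obj :: "('i, 'o, 'a) box \<Rightarrow> bool" where
  "box_obj X \<longleftrightarrow> typed_finite_set (inp X) \<and> typed_finite_set (outp X)"

definition box_sum ::
  "('i, 'o, 'a) box \<Rightarrow> ('j, 'u, 'a) box \<Rightarrow> ('i + 'j, 'o + 'u, 'a) box" where
  "box_sum X Y = \<lparr> inp = typed_sum (inp X) (inp Y), outp = typed_sum (outp X) (outp Y) \<rparr>"

definition box_zero :: "('i, 'o, 'a) box" where
  "box_zero = \<lparr> inp = typed_empty, outp = typed_empty \<rparr>"

record ('i, 'o, 'j, 'u) wiring =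
  win :: "'i \<Rightarrow> 'o + 'j"
  wout :: "'u \<Rightarrow> 'o"

definition wiring_hom ::
  "('i, 'o, 'a) box \<Rightarrow> ('j, 'u, 'a) box \<Rightarrow> ('i, 'o, 'j, 'u) wiring \<Rightarrow> bool" where
  "wiring_hom X Y \<phi> \<longleftrightarrow>
     typed_fun (inp X) (typed_sum (outp X) (inp Y)) (win \<phi>) \<and>
     typed_fun (outp Y) (outp X) (wout \<phi>)"

definition win_hat ::
  "('i, 'o, 'a) box \<Rightarrow> ('j, 'u, 'a) box \<Rightarrow> ('i, 'o, 'j, 'u) wiring \<Rightarrow>
    real \<Rightarrow> ('j \<Rightarrow> 'a) \<times> ('o \<Rightarrow> 'a) \<Rightarrow> 'i \<Rightarrow> 'a" where
  "win_hat X Y \<phi> = (\<lambda>l (y, x). hat_map (inp X) (win \<phi>) l (hat_join (outp X) (inp Y) l (x, y)))"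

definition wout_hat ::
  "('j, 'u, 'a) box \<Rightarrow> ('i, 'o, 'j, 'u) wiring \<Rightarrow> real \<Rightarrow> ('o \<Rightarrow> 'a) \<Rightarrow> 'u \<Rightarrow> 'a" where
  "wout_hat Y \<phi> = hat_map (outp Y) (wout \<phi>)"


section \<open>The algebra of machines and its subalgebras\<close>

type_synonym ('i, 'o, 'a, 's) box_machine = "('s, ('i \<Rightarrow> 'a) \<times> ('o \<Rightarrow> 'a)) over"

text \<open>
  The objects of \<open>Mch(X)\<close> are the \<open>M\<close> with \<open>machine (hat (inp X)) (hat (outp X)) M\<close>, and its
  morphisms are those of the slice, \<open>over_hom\<close>.
\<close>

definition Mch_t :: "('i, 'o, 'a) box \<Rightarrow> ('i, 'o, 'a, 's) box_machine \<Rightarrow> bool" where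
  "Mch_t X M \<longleftrightarrow> total_machine (hat (inp X)) (hat (outp X)) M"

definition Mch_d :: "('i, 'o, 'a) box \<Rightarrow> ('i, 'o, 'a, 's) box_machine \<Rightarrow> bool" where
  "Mch_d X M \<longleftrightarrow> deterministic_machine (hat (inp X)) (hat (outp X)) M"

definition Mch_td :: "('i, 'o, 'a) box \<Rightarrow> ('i, 'o, 'a, 's) box_machine \<Rightarrow> bool" where
  "Mch_td X M \<longleftrightarrow> Mch_t X M \<and> Mch_d X M"

text \<open>The functor \<open>Mch(\<phi>)\<close>, on objects and on morphisms.\<close>

definition over_pullback ::
  "'d presheaf \<Rightarrow> (real \<Rightarrow> 'd \<Rightarrow> 'c) \<Rightarrow> ('s, 'c) over \<Rightarrow> ('d \<times> 's, 'd) over" where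
  "over_pullback D h M = \<lparr> state = pullback D h (state M) (ports M), ports = (\<lambda>l. fst) \<rparr>"

definition over_postcomp :: "(real \<Rightarrow> 'c \<Rightarrow> 'd) \<Rightarrow> ('s, 'c) over \<Rightarrow> ('s, 'd) over" where
  "over_postcomp h M = \<lparr> state = state M, ports = comp_map h (ports M) \<rparr>"

definition Mch_wiring ::
  "('i, 'o, 'a) box \<Rightarrow> ('j, 'u, 'a) box \<Rightarrow> ('i, 'o, 'j, 'u) wiring \<Rightarrow>
    ('i, 'o, 'a, 's) box_machine \<Rightarrow>
    ('j, 'u, 'a, (('j \<Rightarrow> 'a) \<times> ('o \<Rightarrow> 'a)) \<times> 's) box_machine" where
  "Mch_wiring X Y \<phi> M =
     over_postcomp (\<lambda>l (y, x). (y, wout_hat Y \<phi> l x))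
       (over_pullback (sheaf_prod (hat (inp Y)) (hat (outp X)))
          (\<lambda>l (y, x). (win_hat X Y \<phi> l (y, x), x)) M)"

definition Mch_wiring_map :: "(real \<Rightarrow> 's \<Rightarrow> 't) \<Rightarrow> real \<Rightarrow> 'd \<times> 's \<Rightarrow> 'd \<times> 't" where
  "Mch_wiring_map f = (\<lambda>l (d, s). (d, f l s))"

text \<open>The lax structure maps \<open>Mch(X) \<times> Mch(Y) \<rightarrow> Mch(X \<oplus> Y)\<close> and \<open>1 \<rightarrow> Mch(0)\<close>.\<close>

definition Mch_tensor ::
  "('i, 'o, 'a) box \<Rightarrow> ('j, 'u, 'a) box \<Rightarrow>
    ('i, 'o, 'a, 's) box_machine \<Rightarrow> ('j, 'u, 'a, 't) box_machine \<Rightarrow>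
    ('i + 'j, 'o + 'u, 'a, 's \<times> 't) box_machine" where
  "Mch_tensor X Y M N =
     \<lparr> state = sheaf_prod (state M) (state N),
       ports = (\<lambda>l (s, t).
         (hat_join (inp X) (inp Y) l (in_port M l s, in_port N l t),
          hat_join (outp X) (outp Y) l (out_port M l s, out_port N l t))) \<rparr>"

definition Mch_tensor_map ::
  "(real \<Rightarrow> 's \<Rightarrow> 's2) \<Rightarrow> (real \<Rightarrow> 't \<Rightarrow> 't2) \<Rightarrow> real \<Rightarrow> 's \<times> 't \<Rightarrow> 's2 \<times> 't2" where
  "Mch_tensor_map f g = (\<lambda>l (s, t). (f l s, g l t))"

definition Mch_unit :: "('i, 'o, 'a, unit) box_machine" where
  "Mch_unit = \<lparr> state = terminal_sheaf, ports = (\<lambda>l s. (\<lambda>i. undefined, \<lambda>i. undefined)) \<rparr>"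

text \<open>
  Preservation of the full subcategories given by a class of machines. The operations of \<open>Mch\<close>
  change the index types and the type of states, so each predicate below takes the class once
  for every collection of types involved; it is meant to be applied to instances of one
  polymorphic class.
\<close>

definition wiring_closed ::
  "(('i, 'o, 'a) box \<Rightarrow> ('i, 'o, 'a, 's) box_machine \<Rightarrow> bool) \<Rightarrow>
   (('j, 'u, 'a) box \<Rightarrow> ('j, 'u, 'a, (('j \<Rightarrow> 'a) \<times> ('o \<Rightarrow> 'a)) \<times> 's) box_machine \<Rightarrow> bool) \<Rightarrow>
   bool" where
  "wiring_closed P P' \<longleftrightarrow> (\<forall>X Y \<phi>. box_obj X \<longrightarrow> box_obj Y \<longrightarrow> wiring_hom X Y \<phi> \<longrightarrow>
     (\<forall>M. P X M \<longrightarrow> P' Y (Mch_wiring X Y \<phi> M)) \<and>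
     (\<forall>M N f. P X M \<longrightarrow> P X N \<longrightarrow> over_hom M N f \<longrightarrow>
        over_hom (Mch_wiring X Y \<phi> M) (Mch_wiring X Y \<phi> N) (Mch_wiring_map f)))"

definition tensor_closed ::
  "(('i, 'o, 'a) box \<Rightarrow> ('i, 'o, 'a, 's) box_machine \<Rightarrow> bool) \<Rightarrow>
   (('j, 'u, 'a) box \<Rightarrow> ('j, 'u, 'a, 't) box_machine \<Rightarrow> bool) \<Rightarrow>
   (('i + 'j, 'o + 'u, 'a) box \<Rightarrow> ('i + 'j, 'o + 'u, 'a, 's \<times> 't) box_machine \<Rightarrow> bool) \<Rightarrow>
   bool" where
  "tensor_closed P P' P'' \<longleftrightarrow> (\<forall>X Y. box_obj X \<longrightarrow> box_obj Y \<longrightarrow>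
     (\<forall>M N. P X M \<longrightarrow> P' Y N \<longrightarrow> P'' (box_sum X Y) (Mch_tensor X Y M N)) \<and>
     (\<forall>M M' N N' f g. P X M \<longrightarrow> P X M' \<longrightarrow> P' Y N \<longrightarrow> P' Y N' \<longrightarrow>
        over_hom M M' f \<longrightarrow> over_hom N N' g \<longrightarrow>
        over_hom (Mch_tensor X Y M N) (Mch_tensor X Y M' N') (Mch_tensor_map f g)))"

definition unit_closed ::
  "(('i, 'o, 'a) box \<Rightarrow> ('i, 'o, 'a, unit) box_machine \<Rightarrow> bool) \<Rightarrow> bool" where
  "unit_closed P \<longleftrightarrow> P box_zero Mch_unit"

end

theory Submission
  imports Defs
begin

text \<open>
  Totality and determinism are conditions on starting points. The comparison map from
  \<open>Ext e S\<close> to \<open>Ext e A \<times>\<^sub>A S\<close> is an epimorphism for every \<open>e > 0\<close> iff an input of any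
  length can be lifted to a run of states from any compatible initial state, and it is a
  monomorphism for every \<open>e > 0\<close> iff such a lift is unique (\<open>total_map_iff_lifts\<close>,
  \<open>deterministic_map_iff_lifts_unique\<close>). For epimorphisms this uses that a point of an interval
  has no proper covers, so that an epimorphism is surjective on sections of length \<open>0\<close>; from
  there, lifts over longer intervals arise by gluing.

  Gluing also shows that lifts over short intervals suffice (\<open>total_mapI_short\<close>,
  \<open>deterministic_mapI_short\<close>). This is what makes wiring diagrams work. A state of the wired
  machine consists of an outer input \<open>y\<close> and an inner state \<open>s\<close> whose input is the one computed
  from \<open>y\<close> and the output of \<open>s\<close>, so a lifting problem for it looks circular: the inner input
  depends on the output still to be produced. But if the output has inertia \<open>d\<close>, then its part
  over \<open>[0, d]\<close> is a function of the initial state (\<open>inertial_determined\<close>). Over intervals of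
  length at most \<open>d\<close> the inner input is therefore known in advance, and the lifting problem of the
  wired machine becomes one of the inner machine (\<open>lifts_feedback\<close>, \<open>lifts_unique_feedback\<close>).
  The outer output is again inertial, because the inner output with its extension can be
  projected along the diagram.

  Placing machines in parallel turns lifting problems into pairs of lifting problems, and a
  common inertia is the smaller of the two. For the unit all sheaves are terminal.
\<close>


section \<open>Gluing, and maps of presheaves\<close>

lemma sheaf_presheaf: "sheaf X \<Longrightarrow> presheaf X"
  by (simp add: sheaf_def)

lemma sheaf_mapD:
  assumes "sheaf_map A B f"
  shows "0 \<le> l \<Longrightarrow> x \<in> sec A l \<Longrightarrow> f l x \<in> sec B l"
    and "int_hom l' l p \<Longrightarrow> x \<in> sec A l \<Longrightarrow> restr B l p l' (f l x) = f l' (restr A l p l' x)"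
  using assms unfolding sheaf_map_def by auto

lemma sheaf_glue:
  assumes "sheaf X" "0 \<le> l1" "0 \<le> l2" "x1 \<in> sec X l1" "x2 \<in> sec X l2"
    and "restr X l1 l1 0 x1 = restr X l2 0 0 x2"
  obtains x where "x \<in> sec X (l1 + l2)"
    "restr X (l1 + l2) 0 l1 x = x1" "restr X (l1 + l2) l1 l2 x = x2"
  using assms unfolding sheaf_def by blast

lemma sheaf_separated:
  assumes X: "sheaf X" and l: "0 \<le> l1" "0 \<le> l2"
    and x: "x \<in> sec X (l1 + l2)" and y: "y \<in> sec X (l1 + l2)"
    and e: "restr X (l1 + l2) 0 l1 x = restr X (l1 + l2) 0 l1 y"
      "restr X (l1 + l2) l1 l2 x = restr X (l1 + l2) l1 l2 y"
  shows "x = y"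
proof -
  note p = presheafD[OF sheaf_presheaf[OF X]]
  have h: "int_hom l1 (l1 + l2) 0" "int_hom l2 (l1 + l2) l1" "int_hom 0 l1 l1" "int_hom 0 l2 0"
    using l by (auto simp: int_hom_def)
  have "restr X l1 l1 0 (restr X (l1 + l2) 0 l1 x) = restr X l2 0 0 (restr X (l1 + l2) l1 l2 x)"
    using p(3)[OF h(1,3) x] p(3)[OF h(2,4) x] by simp
  then have "\<exists>!z. z \<in> sec X (l1 + l2) \<and>
      restr X (l1 + l2) 0 l1 z = restr X (l1 + l2) 0 l1 x \<and>
      restr X (l1 + l2) l1 l2 z = restr X (l1 + l2) l1 l2 x"
    using X l p(1)[OF h(1) x] p(1)[OF h(2) x] unfolding sheaf_def by blast
  then show ?thesis using x y e by metis
qed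

lemma sheafI:
  assumes "presheaf X"
    and "\<And>l1 l2 x1 x2. 0 \<le> l1 \<Longrightarrow> 0 \<le> l2 \<Longrightarrow> x1 \<in> sec X l1 \<Longrightarrow> x2 \<in> sec X l2 \<Longrightarrow>
        restr X l1 l1 0 x1 = restr X l2 0 0 x2 \<Longrightarrow>
        \<exists>x\<in>sec X (l1 + l2). restr X (l1 + l2) 0 l1 x = x1 \<and> restr X (l1 + l2) l1 l2 x = x2"
    and "\<And>l1 l2 x y. 0 \<le> l1 \<Longrightarrow> 0 \<le> l2 \<Longrightarrow> x \<in> sec X (l1 + l2) \<Longrightarrow> y \<in> sec X (l1 + l2) \<Longrightarrow>
        restr X (l1 + l2) 0 l1 x = restr X (l1 + l2) 0 l1 y \<Longrightarrow>
        restr X (l1 + l2) l1 l2 x = restr X (l1 + l2) l1 l2 y \<Longrightarrow> x = y"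
  shows "sheaf X"
  unfolding sheaf_def
proof (intro conjI allI impI)
  fix l1 l2 x1 x2
  assume h: "0 \<le> l1" "0 \<le> l2" "x1 \<in> sec X l1" "x2 \<in> sec X l2"
    "restr X l1 l1 0 x1 = restr X l2 0 0 x2"
  then show "\<exists>!x. x \<in> sec X (l1 + l2) \<and>
      restr X (l1 + l2) 0 l1 x = x1 \<and> restr X (l1 + l2) l1 l2 x = x2"
    using assms(2)[OF h] assms(3)[OF h(1,2)] by (metis (no_types, lifting))
qed fact

lemma sheaf_map_comp:
  assumes "sheaf_map A B f" "sheaf_map B C g"
  shows "sheaf_map A C (\<lambda>l x. g l (f l x))"
  using assms unfolding sheaf_map_def int_hom_def by auto

lemma sheaf_map_Ext_map:
  assumes e: "0 \<le> e" and f: "sheaf_map A B f"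
  shows "sheaf_map (Ext e A) (Ext e B) (Ext_map e f)"
  using e unfolding sheaf_map_def Ext_def Ext_map_def
  by (simp add: sheaf_mapD[OF f] int_hom_def)

lemma sheaf_map_left_restr:
  assumes A: "presheaf A" and e: "0 \<le> e"
  shows "sheaf_map (Ext e A) A (left_restr e A)"
  using e unfolding sheaf_map_def Ext_def left_restr_def
  by (simp add: presheafD[OF A] int_hom_def)

lemma presheaf_Ext:
  assumes A: "presheaf A" and e: "0 \<le> e"
  shows "presheaf (Ext e A)"
  using e unfolding presheaf_def Ext_def by (simp add: presheafD[OF A] int_hom_def)

text \<open>
  Sections of \<open>Ext e A\<close> over \<open>[0, l1]\<close> and \<open>[l1, l1 + l2]\<close> that match at \<open>l1\<close> are sections of
  \<open>A\<close> over \<open>[0, l1 + e]\<close> and \<open>[l1, l1 + l2 + e]\<close> that agree on the whole overlap. Cutting the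
  first one back to \<open>[0, l1]\<close> leaves a gluing problem in \<open>A\<close>.
\<close>

lemma sheaf_Ext:
  assumes A: "sheaf A" and e: "0 \<le> e"
  shows "sheaf (Ext e A)"
proof (rule sheafI)
  note p = presheafD[OF sheaf_presheaf[OF A]]
  show "presheaf (Ext e A)" by (rule presheaf_Ext[OF sheaf_presheaf[OF A] e])
  fix l1 l2 :: real assume l: "0 \<le> l1" "0 \<le> l2"
  {
    fix x1 x2 assume "x1 \<in> sec (Ext e A) l1" "x2 \<in> sec (Ext e A) l2"
      "restr (Ext e A) l1 l1 0 x1 = restr (Ext e A) l2 0 0 x2"
    then have x: "x1 \<in> sec A (l1 + e)" "x2 \<in> sec A (l2 + e)"
      and eq: "restr A (l1 + e) l1 e x1 = restr A (l2 + e) 0 e x2"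
      by (auto simp: Ext_def)
    have "restr A e 0 0 (restr A (l1 + e) l1 e x1) = restr A e 0 0 (restr A (l2 + e) 0 e x2)"
      using eq by simp
    then have m: "restr A l1 l1 0 (restr A (l1 + e) 0 l1 x1) = restr A (l2 + e) 0 0 x2"
      using l e by (simp add: p(3) x int_hom_def)
    have "restr A (l1 + e) 0 l1 x1 \<in> sec A l1" by (rule p(1)) (use l e x in \<open>auto simp: int_hom_def\<close>)
    then obtain x where xs: "x \<in> sec A (l1 + (l2 + e))"
      "restr A (l1 + (l2 + e)) 0 l1 x = restr A (l1 + e) 0 l1 x1"
      "restr A (l1 + (l2 + e)) l1 (l2 + e) x = x2"
      using sheaf_glue[OF A l(1) _ _ x(2) m] l e by auto
    have "restr A (l1 + (l2 + e)) 0 (l1 + e) x = x1"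
    proof (rule sheaf_separated[OF A l(1) e _ x(1)])
      show "restr A (l1 + (l2 + e)) 0 (l1 + e) x \<in> sec A (l1 + e)"
        by (rule p(1)) (use l e xs in \<open>auto simp: int_hom_def\<close>)
      show "restr A (l1 + e) 0 l1 (restr A (l1 + (l2 + e)) 0 (l1 + e) x) = restr A (l1 + e) 0 l1 x1"
        using l e xs by (simp add: p(3) int_hom_def)
      have "restr A (l2 + e) 0 e (restr A (l1 + (l2 + e)) l1 (l2 + e) x) = restr A (l1 + e) l1 e x1"
        using xs(3) eq by simp
      then show "restr A (l1 + e) l1 e (restr A (l1 + (l2 + e)) 0 (l1 + e) x) = restr A (l1 + e) l1 e x1"
        using l e xs(1) by (simp add: p(3) int_hom_def)
    qed
    with xs show "\<exists>x\<in>sec (Ext e A) (l1 + l2).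
        restr (Ext e A) (l1 + l2) 0 l1 x = x1 \<and> restr (Ext e A) (l1 + l2) l1 l2 x = x2"
      by (auto simp: Ext_def add.assoc)
  next
    fix x y assume "x \<in> sec (Ext e A) (l1 + l2)" "y \<in> sec (Ext e A) (l1 + l2)"
      and "restr (Ext e A) (l1 + l2) 0 l1 x = restr (Ext e A) (l1 + l2) 0 l1 y"
      and "restr (Ext e A) (l1 + l2) l1 l2 x = restr (Ext e A) (l1 + l2) l1 l2 y"
    then have x: "x \<in> sec A (l1 + (l2 + e))" and y: "y \<in> sec A (l1 + (l2 + e))"
      and r: "restr A (l1 + (l2 + e)) 0 (l1 + e) x = restr A (l1 + (l2 + e)) 0 (l1 + e) y"
      and r': "restr A (l1 + (l2 + e)) l1 (l2 + e) x = restr A (l1 + (l2 + e)) l1 (l2 + e) y"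
      by (auto simp: Ext_def add.assoc)
    have "restr A (l1 + e) 0 l1 (restr A (l1 + (l2 + e)) 0 (l1 + e) x) =
        restr A (l1 + e) 0 l1 (restr A (l1 + (l2 + e)) 0 (l1 + e) y)" using r by simp
    then have "restr A (l1 + (l2 + e)) 0 l1 x = restr A (l1 + (l2 + e)) 0 l1 y"
      using l e x y by (simp add: p(3) int_hom_def)
    with r' show "x = y" using sheaf_separated[OF A l(1) _ x y] l e by simp
  }
qed


section \<open>Pullbacks and products\<close>

lemma sec_pullback:
  "(x, y) \<in> sec (pullback A f B g) l \<longleftrightarrow> x \<in> sec A l \<and> y \<in> sec B l \<and> f l x = g l y"
  by (simp add: pullback_def)

lemma restr_pullback:
  "restr (pullback A f B g) l p l' (x, y) = (restr A l p l' x, restr B l p l' y)"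
  by (simp add: pullback_def)

lemma presheaf_pullback:
  assumes A: "presheaf A" and B: "presheaf B" and f: "sheaf_map A C f" and g: "sheaf_map B C g"
  shows "presheaf (pullback A f B g)"
  unfolding presheaf_def
  by (simp add: split_paired_all sec_pullback restr_pullback presheafD[OF A] presheafD[OF B]
      sheaf_mapD(2)[OF f, symmetric] sheaf_mapD(2)[OF g, symmetric])

lemma sheaf_pullback:
  assumes A: "sheaf A" and B: "sheaf B" and C: "sheaf C"
    and f: "sheaf_map A C f" and g: "sheaf_map B C g"
  shows "sheaf (pullback A f B g)"
proof (rule sheafI)
  show "presheaf (pullback A f B g)"
    by (rule presheaf_pullback[OF sheaf_presheaf[OF A] sheaf_presheaf[OF B] f g])
  fix l1 l2 :: real assume l: "0 \<le> l1" "0 \<le> l2"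
  then have h: "int_hom l1 (l1 + l2) 0" "int_hom l2 (l1 + l2) l1" "0 \<le> l1 + l2"
    by (auto simp: int_hom_def)
  {
    fix z1 z2 assume z: "z1 \<in> sec (pullback A f B g) l1" "z2 \<in> sec (pullback A f B g) l2"
      and eq: "restr (pullback A f B g) l1 l1 0 z1 = restr (pullback A f B g) l2 0 0 z2"
    obtain x1 y1 x2 y2 where zz: "z1 = (x1, y1)" "z2 = (x2, y2)" by fastforce
    obtain x where x: "x \<in> sec A (l1 + l2)"
      "restr A (l1 + l2) 0 l1 x = x1" "restr A (l1 + l2) l1 l2 x = x2"
      by (rule sheaf_glue[OF A l, of x1 x2]) (use z eq zz in \<open>auto simp: sec_pullback restr_pullback\<close>)
    obtain y where y: "y \<in> sec B (l1 + l2)"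
      "restr B (l1 + l2) 0 l1 y = y1" "restr B (l1 + l2) l1 l2 y = y2"
      by (rule sheaf_glue[OF B l, of y1 y2]) (use z eq zz in \<open>auto simp: sec_pullback restr_pullback\<close>)
    have "f (l1 + l2) x = g (l1 + l2) y"
      by (rule sheaf_separated[OF C l])
        (use z zz x y h in \<open>auto simp: sec_pullback sheaf_mapD[OF f] sheaf_mapD[OF g]\<close>)
    with x y zz show "\<exists>z\<in>sec (pullback A f B g) (l1 + l2).
        restr (pullback A f B g) (l1 + l2) 0 l1 z = z1 \<and>
        restr (pullback A f B g) (l1 + l2) l1 l2 z = z2"
      by (intro bexI[of _ "(x, y)"]) (auto simp: sec_pullback restr_pullback)
  next
    fix z z' assume "z \<in> sec (pullback A f B g) (l1 + l2)" "z' \<in> sec (pullback A f B g) (l1 + l2)"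
      and "restr (pullback A f B g) (l1 + l2) 0 l1 z = restr (pullback A f B g) (l1 + l2) 0 l1 z'"
      and "restr (pullback A f B g) (l1 + l2) l1 l2 z = restr (pullback A f B g) (l1 + l2) l1 l2 z'"
    then show "z = z'"
      using sheaf_separated[OF A l] sheaf_separated[OF B l]
      by (cases z; cases z') (auto simp: sec_pullback restr_pullback)
  }
qed

lemma sheaf_terminal: "sheaf terminal_sheaf"
  unfolding sheaf_def presheaf_def by (auto simp: terminal_sheaf_def)

lemma sheaf_map_terminal: "sheaf_map A terminal_sheaf (\<lambda>l x. ())"
  by (simp add: sheaf_map_def terminal_sheaf_def)

lemma sheaf_prod_pullback: "sheaf_prod A B = pullback A (\<lambda>l x. ()) B (\<lambda>l x. ())"
  unfolding sheaf_prod_def pullback_def by auto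

lemma sheaf_sheaf_prod: "sheaf A \<Longrightarrow> sheaf B \<Longrightarrow> sheaf (sheaf_prod A B)"
  unfolding sheaf_prod_pullback
  by (rule sheaf_pullback[OF _ _ sheaf_terminal sheaf_map_terminal sheaf_map_terminal])

lemma sec_sheaf_prod: "(x, y) \<in> sec (sheaf_prod A B) l \<longleftrightarrow> x \<in> sec A l \<and> y \<in> sec B l"
  by (simp add: sheaf_prod_def)

lemma restr_sheaf_prod:
  "restr (sheaf_prod A B) l p l' (x, y) = (restr A l p l' x, restr B l p l' y)"
  by (simp add: sheaf_prod_def)

lemma sheaf_map_into_pullback:
  assumes "sheaf_map Z A g" "sheaf_map Z B h"
    and "\<And>l z. 0 \<le> l \<Longrightarrow> z \<in> sec Z l \<Longrightarrow> f l (g l z) = k l (h l z)"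
  shows "sheaf_map Z (pullback A f B k) (\<lambda>l z. (g l z, h l z))"
  using assms unfolding sheaf_map_def by (auto simp: sec_pullback restr_pullback)

lemma sheaf_map_into_prod:
  assumes "sheaf_map Z A g" "sheaf_map Z B h"
  shows "sheaf_map Z (sheaf_prod A B) (\<lambda>l z. (g l z, h l z))"
  using assms unfolding sheaf_prod_pullback by (intro sheaf_map_into_pullback) auto

lemma sheaf_map_pullback_fst: "sheaf_map (pullback A f B g) A (\<lambda>l. fst)"
  unfolding sheaf_map_def by (auto simp: sec_pullback restr_pullback)

lemma sheaf_map_pullback_snd: "sheaf_map (pullback A f B g) B (\<lambda>l. snd)"
  unfolding sheaf_map_def by (auto simp: sec_pullback restr_pullback)

lemmas sheaf_map_prod_fst = sheaf_map_pullback_fst[of A "\<lambda>l x. ()" B "\<lambda>l x. ()" for A B,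
    folded sheaf_prod_pullback]
lemmas sheaf_map_prod_snd = sheaf_map_pullback_snd[of A "\<lambda>l x. ()" B "\<lambda>l x. ()" for A B,
    folded sheaf_prod_pullback]


section \<open>Totality and determinism as lifting from a point\<close>

text \<open>
  Surjectivity and injectivity of the map from \<open>S(e)\<close> to \<open>A(e) \<times> S(0)\<close>, fibred over \<open>A(0)\<close>,
  that takes \<open>s\<close> to \<open>p s\<close> and the starting point of \<open>s\<close>.
\<close>

definition lifts :: "'s presheaf \<Rightarrow> 'a presheaf \<Rightarrow> (real \<Rightarrow> 's \<Rightarrow> 'a) \<Rightarrow> real \<Rightarrow> bool" where
  "lifts S A p e \<longleftrightarrow> (\<forall>a\<in>sec A e. \<forall>s0\<in>sec S 0. restr A e 0 0 a = p 0 s0 \<longrightarrow>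
     (\<exists>s\<in>sec S e. p e s = a \<and> restr S e 0 0 s = s0))"

definition lifts_unique :: "'s presheaf \<Rightarrow> (real \<Rightarrow> 's \<Rightarrow> 'a) \<Rightarrow> real \<Rightarrow> bool" where
  "lifts_unique S p e \<longleftrightarrow> (\<forall>s\<in>sec S e. \<forall>t\<in>sec S e. p e s = p e t \<longrightarrow>
     restr S e 0 0 s = restr S e 0 0 t \<longrightarrow> s = t)"

text \<open>
  A lift of the initial part is continued by lifting the remaining part from the end point
  reached so far, and gluing.
\<close>

lemma lifts_continue:
  assumes S: "sheaf S" and A: "sheaf A" and p: "sheaf_map S A p" and L: "lifts S A p e"
    and l: "0 \<le> l" "0 \<le> e" and s: "s \<in> sec S l" and a: "a \<in> sec A (l + e)"
    and as: "restr A (l + e) 0 l a = p l s"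
  shows "\<exists>t\<in>sec S (l + e). p (l + e) t = a \<and> restr S (l + e) 0 l t = s"
proof -
  note pA = presheafD[OF sheaf_presheaf[OF A]] and pS = presheafD[OF sheaf_presheaf[OF S]]
  have h: "int_hom 0 l l" "int_hom e (l + e) l" "int_hom l (l + e) 0" "int_hom 0 e 0" "0 \<le> l + e"
    using l by (auto simp: int_hom_def)
  have "restr A e 0 0 (restr A (l + e) l e a) = restr A l l 0 (restr A (l + e) 0 l a)"
    using pA(3)[OF h(2,4) a] pA(3)[OF h(3,1) a] by simp
  also have "\<dots> = p 0 (restr S l l 0 s)" unfolding as by (rule sheaf_mapD(2)[OF p h(1) s])
  finally obtain r where r: "r \<in> sec S e" "p e r = restr A (l + e) l e a"
    "restr S e 0 0 r = restr S l l 0 s"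
    using L pA(1)[OF h(2) a] pS(1)[OF h(1) s] unfolding lifts_def by blast
  obtain t where t: "t \<in> sec S (l + e)" "restr S (l + e) 0 l t = s" "restr S (l + e) l e t = r"
    by (rule sheaf_glue[OF S l s r(1) r(3)[symmetric]])
  have "p (l + e) t = a"
    by (rule sheaf_separated[OF A l _ a])
      (use h t r as in \<open>simp_all add: sheaf_mapD[OF p]\<close>)
  with t show ?thesis by blast
qed

lemma lifts_unique_continue:
  assumes S: "sheaf S" and p: "sheaf_map S A p" and L: "lifts_unique S p e"
    and l: "0 \<le> l" "0 \<le> e" and s: "s \<in> sec S (l + e)" and t: "t \<in> sec S (l + e)"
    and eq: "p (l + e) s = p (l + e) t" "restr S (l + e) 0 l s = restr S (l + e) 0 l t"
  shows "s = t"
proof -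
  note pS = presheafD[OF sheaf_presheaf[OF S]]
  have h: "int_hom 0 l l" "int_hom e (l + e) l" "int_hom l (l + e) 0" "int_hom 0 e 0"
    using l by (auto simp: int_hom_def)
  have "p e (restr S (l + e) l e s) = p e (restr S (l + e) l e t)"
    using sheaf_mapD(2)[OF p h(2) s] sheaf_mapD(2)[OF p h(2) t] eq(1) by simp
  moreover have "restr S e 0 0 (restr S (l + e) l e s) = restr S e 0 0 (restr S (l + e) l e t)"
    using pS(3)[OF h(2,4) s] pS(3)[OF h(3,1) s] pS(3)[OF h(2,4) t] pS(3)[OF h(3,1) t] eq(2)
    by simp
  ultimately have "restr S (l + e) l e s = restr S (l + e) l e t"
    using L pS(1)[OF h(2) s] pS(1)[OF h(2) t] unfolding lifts_unique_def by blast
  then show ?thesis by (rule sheaf_separated[OF S l s t eq(2)])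
qed

lemma lifts_add:
  assumes S: "sheaf S" and A: "sheaf A" and p: "sheaf_map S A p"
    and L: "lifts S A p d" "lifts S A p e" and l: "0 \<le> d" "0 \<le> e"
  shows "lifts S A p (d + e)"
  unfolding lifts_def
proof (intro ballI impI)
  note pA = presheafD[OF sheaf_presheaf[OF A]] and pS = presheafD[OF sheaf_presheaf[OF S]]
  have h: "int_hom d (d + e) 0" "int_hom 0 d 0" using l by (auto simp: int_hom_def)
  fix a s0 assume a: "a \<in> sec A (d + e)" and s0: "s0 \<in> sec S 0"
    and eq: "restr A (d + e) 0 0 a = p 0 s0"
  have "restr A d 0 0 (restr A (d + e) 0 d a) = p 0 s0" using pA(3)[OF h a] eq by simp
  then obtain s where s: "s \<in> sec S d" "p d s = restr A (d + e) 0 d a" "restr S d 0 0 s = s0"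
    using L(1) pA(1)[OF h(1) a] s0 unfolding lifts_def by blast
  obtain t where t: "t \<in> sec S (d + e)" "p (d + e) t = a" "restr S (d + e) 0 d t = s"
    using lifts_continue[OF S A p L(2) l s(1) a s(2)[symmetric]] by blast
  with s(3) pS(3)[OF h t(1)] show "\<exists>s\<in>sec S (d + e). p (d + e) s = a \<and> restr S (d + e) 0 0 s = s0"
    by auto
qed

lemma lifts_unique_add:
  assumes S: "sheaf S" and p: "sheaf_map S A p"
    and L: "lifts_unique S p d" "lifts_unique S p e" and l: "0 \<le> d" "0 \<le> e"
  shows "lifts_unique S p (d + e)"
  unfolding lifts_unique_def
proof (intro ballI impI)
  note pS = presheafD[OF sheaf_presheaf[OF S]]
  have h: "int_hom d (d + e) 0" "int_hom 0 d 0" using l by (auto simp: int_hom_def)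
  fix s t assume s: "s \<in> sec S (d + e)" and t: "t \<in> sec S (d + e)" and eq: "p (d + e) s = p (d + e) t"
    and r: "restr S (d + e) 0 0 s = restr S (d + e) 0 0 t"
  have "p d (restr S (d + e) 0 d s) = p d (restr S (d + e) 0 d t)"
    using sheaf_mapD(2)[OF p h(1) s] sheaf_mapD(2)[OF p h(1) t] eq by simp
  moreover have "restr S d 0 0 (restr S (d + e) 0 d s) = restr S d 0 0 (restr S (d + e) 0 d t)"
    using pS(3)[OF h s] pS(3)[OF h t] r by simp
  ultimately have "restr S (d + e) 0 d s = restr S (d + e) 0 d t"
    using L(1) pS(1)[OF h(1) s] pS(1)[OF h(1) t] unfolding lifts_unique_def by blast
  then show "s = t" by (rule lifts_unique_continue[OF S p L(2) l s t eq])
qed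

lemma pos_real_induct_short:
  fixes d e :: real
  assumes d: "0 < d" and short: "\<And>e. 0 < e \<Longrightarrow> e \<le> d \<Longrightarrow> P e"
    and add: "\<And>e e'. 0 < e \<Longrightarrow> 0 < e' \<Longrightarrow> P e \<Longrightarrow> P e' \<Longrightarrow> P (e + e')" and e: "0 < e"
  shows "P e"
proof -
  have *: "\<forall>e. 0 < e \<longrightarrow> e \<le> real n * d \<longrightarrow> P e" for n
  proof (induction n)
    case (Suc n)
    have "P e" if "0 < e" "e \<le> real (Suc n) * d" for e
    proof (cases "e \<le> d")
      case False
      then have "P (e - d)" using Suc.IH that by (simp add: algebra_simps)
      then show ?thesis using add[of "e - d" d] short[of d] d False by simp
    qed (use short that in simp)
    then show ?case by blast
  qed simp
  obtain n where "e < real n * d" using ex_less_of_nat_mult[OF d] by blast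
  then show ?thesis using *[of n] e by simp
qed

text \<open>
  In general an epimorphism of sheaves is only locally surjective, but a point has no proper
  covers. For the proof, a section \<open>b\<close> is sent to the closed sieve of all intervals at every point
  of which \<open>b\<close> restricts into the image of \<open>f\<close>; on the image this map to the classifier agrees
  with the constant maximal sieve.
\<close>

lemma sheaf_epi_surj_points:
  assumes A: "presheaf A" and B: "presheaf B" and f: "sheaf_epi A B f" and b: "b \<in> sec B 0"
  shows "\<exists>a\<in>sec A 0. f 0 a = b"
proof -
  define I where "I = f 0 ` sec A 0"
  define u where "u = (\<lambda>l b. {(p, m). int_hom m l p \<and>
     (\<forall>q. p \<le> q \<longrightarrow> q \<le> p + m \<longrightarrow> restr B l q 0 b \<in> I)})"
  define v :: "real \<Rightarrow> 'b \<Rightarrow> probe" where "v = (\<lambda>l b. {(p, m). int_hom m l p})"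
  note B' = presheafD[OF B]
  have fm: "sheaf_map A B f" using f by (simp add: sheaf_epi_def)
  have uiff: "(p, m) \<in> u l b \<longleftrightarrow> int_hom m l p \<and>
      (\<forall>q. p \<le> q \<longrightarrow> q \<le> p + m \<longrightarrow> restr B l q 0 b \<in> I)" for p m l b
    by (simp add: u_def)
  have "sheaf_map B classifier u"
    unfolding sheaf_map_def
  proof (intro conjI allI impI)
    fix l b assume "0 \<le> l" "b \<in> sec B l"
    have "(p + q, k) \<in> u l b" if "(p, m) \<in> u l b" "int_hom k m q" for p m q k
      using that by (auto simp: uiff int_hom_def)
    moreover have "(p, m + k) \<in> u l b" if "(p, m) \<in> u l b" "(p + m, k) \<in> u l b" for p m k
      unfolding uiff
    proof (intro conjI allI impI)
      show "int_hom (m + k) l p" using that by (auto simp: uiff int_hom_def)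
      show "restr B l q 0 b \<in> I" if "p \<le> q" "q \<le> p + (m + k)" for q
        using \<open>(p, m) \<in> u l b\<close> \<open>(p + m, k) \<in> u l b\<close> that
        by (cases "q \<le> p + m") (simp_all add: uiff)
    qed
    moreover have "\<forall>p m. (p, m) \<in> u l b \<longrightarrow> int_hom m l p" by (simp add: uiff)
    ultimately show "u l b \<in> sec classifier l" by (simp add: classifier_def)
  next
    fix l p l' b assume h: "int_hom l' l p" and b: "b \<in> sec B l"
    show "u l' (restr B l p l' b) = restr classifier l p l' (u l b)"
    proof (intro set_eqI, clarify)
      fix q m
      have "(\<forall>r. q \<le> r \<longrightarrow> r \<le> q + m \<longrightarrow> restr B l' r 0 (restr B l p l' b) \<in> I) \<longleftrightarrow>
          (\<forall>r. p + q \<le> r \<longrightarrow> r \<le> p + q + m \<longrightarrow> restr B l r 0 b \<in> I)" (is "?L \<longleftrightarrow> ?R")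
        if i: "int_hom m l' q"
      proof -
        have *: "restr B l' r 0 (restr B l p l' b) = restr B l (p + r) 0 b"
          if "q \<le> r" "r \<le> q + m" for r
          by (rule B'(3)[OF h _ b]) (use that i in \<open>auto simp: int_hom_def\<close>)
        have ?R if ?L
        proof (intro allI impI)
          fix r assume r: "p + q \<le> r" "r \<le> p + q + m"
          then have "restr B l' (r - p) 0 (restr B l p l' b) \<in> I" using that by simp
          then show "restr B l r 0 b \<in> I" using *[of "r - p"] r by simp
        qed
        moreover have ?L if ?R using that * by simp
        ultimately show ?thesis by blast
      qed
      moreover have "int_hom m l' q \<Longrightarrow> int_hom m l (p + q)" using h by (auto simp: int_hom_def)
      ultimately show "(q, m) \<in> u l' (restr B l p l' b) \<longleftrightarrow> (q, m) \<in> restr classifier l p l' (u l b)"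
        by (simp add: uiff classifier_def) blast
    qed
  qed
  moreover have "sheaf_map B classifier v"
    unfolding sheaf_map_def by (auto simp: v_def classifier_def int_hom_def)
  moreover have "map_eq A (comp_map u f) (comp_map v f)"
    unfolding map_eq_def comp_map_def
  proof (intro allI impI)
    fix l a assume l: "0 \<le> l" and a: "a \<in> sec A l"
    have "restr B l q 0 (f l a) \<in> I" if "int_hom m l p" "p \<le> q" "q \<le> p + m" for p m q
    proof -
      have h: "int_hom 0 l q" using that by (auto simp: int_hom_def)
      show ?thesis
        unfolding I_def sheaf_mapD(2)[OF fm h a] by (rule imageI[OF presheafD(1)[OF A h a]])
    qed
    then show "u l (f l a) = v l (f l a)" by (auto simp: u_def v_def)
  qed
  ultimately have "u 0 b = v 0 b"
    using f sheaf_classifier b unfolding sheaf_epi_def map_eq_def by blast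
  moreover have "(0, 0) \<in> v 0 b" by (simp add: v_def int_hom_def)
  ultimately have "(0, 0) \<in> u 0 b" by simp
  then have "restr B 0 0 0 b \<in> I" unfolding uiff by simp
  then show ?thesis using B'(2)[OF _ b] by (auto simp: I_def)
qed


lemma sheaf_map_lift_comparison:
  assumes S: "presheaf S" and p: "sheaf_map S A p" and e: "0 \<le> e"
  shows "sheaf_map (Ext e S) (pullback (Ext e A) (left_restr e A) S p)
    (\<lambda>l s. (Ext_map e p l s, left_restr e S l s))"
proof (rule sheaf_map_into_pullback[OF sheaf_map_Ext_map[OF e p] sheaf_map_left_restr[OF S e]])
  fix l s assume l: "0 \<le> l" and "s \<in> sec (Ext e S) l"
  then have "int_hom l (l + e) 0" "s \<in> sec S (l + e)" using e by (auto simp: int_hom_def Ext_def)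
  then show "left_restr e A l (Ext_map e p l s) = p l (left_restr e S l s)"
    by (simp add: left_restr_def Ext_map_def sheaf_mapD(2)[OF p])
qed

text \<open>
  Sections of length \<open>0\<close> show that an epimorphic comparison map yields lifts. Conversely, lifts
  make the comparison map surjective in every length \<open>l\<close>, by continuing from the end point.
\<close>

lemma total_map_iff_lifts:
  assumes S: "sheaf S" and A: "sheaf A" and p: "sheaf_map S A p"
  shows "total_map S A p \<longleftrightarrow> (\<forall>e>0. lifts S A p e)"
proof (intro iffI allI impI)
  fix e :: real assume T: "total_map S A p" and e: "0 < e"
  let ?Q = "pullback (Ext e A) (left_restr e A) S p"
  have "presheaf ?Q"
    using e by (intro presheaf_pullback[OF presheaf_Ext[OF sheaf_presheaf[OF A]]
        sheaf_presheaf[OF S] sheaf_map_left_restr[OF sheaf_presheaf[OF A]] p]) auto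
  then have surj: "\<exists>s\<in>sec (Ext e S) 0. (Ext_map e p 0 s, left_restr e S 0 s) = b"
    if "b \<in> sec ?Q 0" for b
    using sheaf_epi_surj_points[OF presheaf_Ext[OF sheaf_presheaf[OF S]], of e ?Q
        "\<lambda>l s. (Ext_map e p l s, left_restr e S l s)" b] T e that
    unfolding total_map_def by auto
  show "lifts S A p e"
    unfolding lifts_def
  proof (intro ballI impI)
    fix a s0 assume "a \<in> sec A e" "s0 \<in> sec S 0" "restr A e 0 0 a = p 0 s0"
    then have "(a, s0) \<in> sec ?Q 0" by (simp add: sec_pullback Ext_def left_restr_def)
    from surj[OF this] show "\<exists>s\<in>sec S e. p e s = a \<and> restr S e 0 0 s = s0"
      by (simp add: Ext_def Ext_map_def left_restr_def)
  qed
next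
  assume L: "\<forall>e>0. lifts S A p e"
  show "total_map S A p"
    unfolding total_map_def sheaf_epi_def
  proof (intro allI impI conjI)
    fix e :: real assume e: "0 < e"
    let ?Q = "pullback (Ext e A) (left_restr e A) S p"
    show "sheaf_map (Ext e S) ?Q (\<lambda>l s. (Ext_map e p l s, left_restr e S l s))"
      using e by (intro sheaf_map_lift_comparison[OF sheaf_presheaf[OF S] p]) simp
    fix Z :: "probe presheaf" and g g'
    assume eq: "map_eq (Ext e S) (comp_map g (\<lambda>l s. (Ext_map e p l s, left_restr e S l s)))
      (comp_map g' (\<lambda>l s. (Ext_map e p l s, left_restr e S l s)))"
    show "map_eq ?Q g g'"
      unfolding map_eq_def
    proof (intro allI impI)
      fix l z assume l: "0 \<le> l" and z: "z \<in> sec ?Q l"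
      obtain a s where as: "z = (a, s)" by fastforce
      with z have "s \<in> sec S l" "a \<in> sec A (l + e)" "restr A (l + e) 0 l a = p l s"
        by (auto simp: sec_pullback Ext_def left_restr_def)
      then obtain t where "t \<in> sec S (l + e)" "p (l + e) t = a" "restr S (l + e) 0 l t = s"
        using lifts_continue[OF S A p _ l, of e s a] L e by auto
      then show "g l z = g' l z"
        using eq l unfolding map_eq_def comp_map_def as
        by (auto simp: Ext_def Ext_map_def left_restr_def)
    qed
  qed
qed

lemma deterministic_map_iff_lifts_unique:
  assumes S: "sheaf S" and A: "sheaf A" and p: "sheaf_map S A p"
  shows "deterministic_map S A p \<longleftrightarrow> (\<forall>e>0. lifts_unique S p e)"
proof (intro iffI allI impI)
  fix e :: real assume D: "deterministic_map S A p" and e: "0 < e"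
  show "lifts_unique S p e"
    unfolding lifts_unique_def
  proof (intro ballI impI)
    fix s t assume st: "s \<in> sec S e" "t \<in> sec S e" "p e s = p e t" "restr S e 0 0 s = restr S e 0 0 t"
    have mono: "sheaf_mono (Ext e S) (pullback (Ext e A) (left_restr e A) S p)
        (\<lambda>l s. (Ext_map e p l s, left_restr e S l s))"
      using D e unfolding deterministic_map_def by blast
    show "s = t"
      by (rule sheaf_mono_inj[OF sheaf_Ext[OF S] mono, of 0])
        (use st e in \<open>auto simp: Ext_def Ext_map_def left_restr_def\<close>)
  qed
next
  assume L: "\<forall>e>0. lifts_unique S p e"
  show "deterministic_map S A p"
    unfolding deterministic_map_def sheaf_mono_def
  proof (intro allI impI conjI)
    fix e :: real assume e: "0 < e"
    show "sheaf_map (Ext e S) (pullback (Ext e A) (left_restr e A) S p)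
        (\<lambda>l s. (Ext_map e p l s, left_restr e S l s))"
      using e by (intro sheaf_map_lift_comparison[OF sheaf_presheaf[OF S] p]) simp
    fix Z :: "probe presheaf" and g g'
    assume g: "sheaf_map Z (Ext e S) g" "sheaf_map Z (Ext e S) g'"
      and eq: "map_eq Z (comp_map (\<lambda>l s. (Ext_map e p l s, left_restr e S l s)) g)
        (comp_map (\<lambda>l s. (Ext_map e p l s, left_restr e S l s)) g')"
    show "map_eq Z g g'"
      unfolding map_eq_def
    proof (intro allI impI)
      fix l z assume l: "0 \<le> l" and z: "z \<in> sec Z l"
      show "g l z = g' l z"
      proof (rule lifts_unique_continue[OF S p _ l, of e])
        show "g l z \<in> sec S (l + e)" "g' l z \<in> sec S (l + e)"
          using sheaf_mapD(1)[OF g(1) l z] sheaf_mapD(1)[OF g(2) l z] by (auto simp: Ext_def)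
        show "p (l + e) (g l z) = p (l + e) (g' l z)"
          "restr S (l + e) 0 l (g l z) = restr S (l + e) 0 l (g' l z)"
          using eq l z by (auto simp: map_eq_def comp_map_def Ext_map_def left_restr_def)
      qed (use L e in auto)
    qed
  qed
qed

text \<open>
  In a wired machine, inertia gives control of the fed back output only up to a delay \<open>d\<close>;
  longer runs are concatenations of runs of length at most \<open>d\<close>.
\<close>

lemma total_mapI_short:
  assumes S: "sheaf S" and A: "sheaf A" and p: "sheaf_map S A p" and d: "0 < d"
    and L: "\<And>e. 0 < e \<Longrightarrow> e \<le> d \<Longrightarrow> lifts S A p e"
  shows "total_map S A p"
  unfolding total_map_iff_lifts[OF S A p]
  using pos_real_induct_short[of d "lifts S A p", OF d L] lifts_add[OF S A p] by auto

lemma deterministic_mapI_short: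
  assumes S: "sheaf S" and A: "sheaf A" and p: "sheaf_map S A p" and d: "0 < d"
    and L: "\<And>e. 0 < e \<Longrightarrow> e \<le> d \<Longrightarrow> lifts_unique S p e"
  shows "deterministic_map S A p"
  unfolding deterministic_map_iff_lifts_unique[OF S A p]
  using pos_real_induct_short[of d "lifts_unique S p", OF d L] lifts_unique_add[OF S p] by auto


section \<open>Inertial maps\<close>

text \<open>
  Up to the inertia \<open>d\<close> the output is a function of the initial state alone. This is what breaks
  the circularity of feeding outputs back into inputs.
\<close>

lemma inertial_determined:
  assumes S: "presheaf S" and B: "presheaf B"
    and q: "sheaf_map S (Ext d B) q" and pq: "map_eq S p (comp_map (left_restr d B) q)"
    and e: "0 \<le> e" "e \<le> d" and s: "s \<in> sec S e"
  shows "p e s = restr B d 0 e (q 0 (restr S e 0 0 s))"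
proof -
  have h: "int_hom 0 e 0" "int_hom d (e + d) 0" "int_hom e d 0" using e by (auto simp: int_hom_def)
  have x: "q e s \<in> sec B (e + d)" using sheaf_mapD(1)[OF q e(1) s] by (simp add: Ext_def)
  have "p e s = restr B (e + d) 0 e (q e s)"
    using pq e s by (simp add: map_eq_def comp_map_def left_restr_def)
  also have "\<dots> = restr B d 0 e (restr B (e + d) 0 d (q e s))"
    using presheafD(3)[OF B h(2,3) x] by simp
  also have "restr B (e + d) 0 d (q e s) = q 0 (restr S e 0 0 s)"
    using sheaf_mapD(2)[OF q h(1) s] by (simp add: Ext_def)
  finally show ?thesis .
qed

lemma inertial_map_shorten:
  assumes B: "presheaf B"
    and q: "sheaf_map S (Ext e B) q" and pq: "map_eq S p (comp_map (left_restr e B) q)"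
    and d: "0 \<le> d" "d \<le> e"
  shows "\<exists>r. sheaf_map S (Ext d B) r \<and> map_eq S p (comp_map (left_restr d B) r)"
proof (intro exI conjI)
  let ?r = "\<lambda>l s. restr B (l + e) 0 (l + d) (q l s)"
  have x: "q l s \<in> sec B (l + e)" if "0 \<le> l" "s \<in> sec S l" for l s
    using sheaf_mapD(1)[OF q that] by (simp add: Ext_def)
  have n: "q l' (restr S l p l' s) = restr B (l + e) p (l' + e) (q l s)"
    if "int_hom l' l p" "s \<in> sec S l" for l' l p s
    using sheaf_mapD(2)[OF q that] by (simp add: Ext_def)
  show "sheaf_map S (Ext d B) ?r"
    unfolding sheaf_map_def Ext_def
    using d by (simp add: presheafD[OF B] x n int_hom_def)
  show "map_eq S p (comp_map (left_restr d B) ?r)"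
    using pq d unfolding map_eq_def comp_map_def left_restr_def
    by (simp add: presheafD[OF B] x int_hom_def)
qed

lemma inertial_map_postcomp:
  assumes p: "inertial_map S B p" and f: "sheaf_map B C f"
  shows "inertial_map S C (\<lambda>l s. f l (p l s))"
proof -
  obtain d q where d: "0 < d" and q: "sheaf_map S (Ext d B) q"
    and pq: "map_eq S p (comp_map (left_restr d B) q)"
    using p unfolding inertial_map_def by blast
  have "sheaf_map S (Ext d C) (\<lambda>l s. Ext_map d f l (q l s))"
    using d by (intro sheaf_map_comp[OF q sheaf_map_Ext_map[OF _ f]]) simp
  moreover have "f l (p l s) = restr C (l + d) 0 l (Ext_map d f l (q l s))"
    if l: "0 \<le> l" "s \<in> sec S l" for l s
  proof -
    have "q l s \<in> sec B (l + d)" using sheaf_mapD(1)[OF q l] by (simp add: Ext_def)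
    then show ?thesis
      using l d pq by (simp add: Ext_map_def sheaf_mapD(2)[OF f] int_hom_def map_eq_def
          comp_map_def left_restr_def)
  qed
  ultimately show ?thesis
    using d unfolding inertial_map_def map_eq_def comp_map_def left_restr_def by blast
qed

lemma inertial_map_precomp:
  assumes p: "inertial_map S B p" and f: "sheaf_map T S f"
  shows "inertial_map T B (\<lambda>l t. p l (f l t))"
proof -
  obtain d q where d: "0 < d" and q: "sheaf_map S (Ext d B) q"
    and pq: "map_eq S p (comp_map (left_restr d B) q)"
    using p unfolding inertial_map_def by blast
  have "map_eq T (\<lambda>l t. p l (f l t)) (comp_map (left_restr d B) (\<lambda>l t. q l (f l t)))"
    using pq sheaf_mapD(1)[OF f] unfolding map_eq_def comp_map_def by blast
  then show ?thesis using d sheaf_map_comp[OF f q] unfolding inertial_map_def by blast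
qed

lemma inertial_map_prod:
  assumes B: "presheaf B" and C: "presheaf C"
    and p: "inertial_map S B p" and r: "inertial_map S C r"
  shows "inertial_map S (sheaf_prod B C) (\<lambda>l s. (p l s, r l s))"
proof -
  obtain d q where d: "0 < d" and q: "sheaf_map S (Ext d B) q"
    "map_eq S p (comp_map (left_restr d B) q)"
    using p unfolding inertial_map_def by blast
  obtain d' q' where d': "0 < d'" and q': "sheaf_map S (Ext d' C) q'"
    "map_eq S r (comp_map (left_restr d' C) q')"
    using r unfolding inertial_map_def by blast
  define e where "e = min d d'"
  obtain u where u: "sheaf_map S (Ext e B) u" "map_eq S p (comp_map (left_restr e B) u)"
    using inertial_map_shorten[OF B q, of e] d d' by (auto simp: e_def)
  obtain v where v: "sheaf_map S (Ext e C) v" "map_eq S r (comp_map (left_restr e C) v)"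
    using inertial_map_shorten[OF C q', of e] d d' by (auto simp: e_def)
  have "Ext e (sheaf_prod B C) = sheaf_prod (Ext e B) (Ext e C)"
    by (simp add: Ext_def sheaf_prod_def)
  then have "sheaf_map S (Ext e (sheaf_prod B C)) (\<lambda>l s. (u l s, v l s))"
    using sheaf_map_into_prod[OF u(1) v(1)] by simp
  moreover have "map_eq S (\<lambda>l s. (p l s, r l s))
      (comp_map (left_restr e (sheaf_prod B C)) (\<lambda>l s. (u l s, v l s)))"
    using u(2) v(2) by (simp add: map_eq_def comp_map_def left_restr_def restr_sheaf_prod)
  ultimately show ?thesis
    using d d' unfolding inertial_map_def by (intro exI[of _ e]) (auto simp: e_def)
qed


section \<open>Feeding outputs back into inputs\<close>

lemma machine_iff:
  "machine A B M \<longleftrightarrow> sheaf (state M) \<and>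
     sheaf_map (state M) A (in_port M) \<and> sheaf_map (state M) B (out_port M)"
  (is "?L \<longleftrightarrow> ?R")
proof
  assume L: ?L
  then have p: "sheaf_map (state M) (sheaf_prod A B) (ports M)"
    by (simp add: machine_def over_obj_def)
  show ?R
    using L sheaf_map_comp[OF p sheaf_map_prod_fst] sheaf_map_comp[OF p sheaf_map_prod_snd]
    unfolding machine_def over_obj_def in_port_def out_port_def by simp
next
  assume ?R
  then show ?L
    using sheaf_map_into_prod[of "state M" A "in_port M" B "out_port M"]
    by (simp add: machine_def over_obj_def in_port_def out_port_def)
qed

text \<open>
  The effect of a wiring diagram with arbitrary sheaves in place of products over wires: \<open>w\<close>
  computes the inner input from the outer input and the inner output, and \<open>v\<close> computes the
  outer output from the inner one.
\<close>

definition feedback ::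
  "'y presheaf \<Rightarrow> 'b presheaf \<Rightarrow> (real \<Rightarrow> 'y \<times> 'b \<Rightarrow> 'a) \<Rightarrow> (real \<Rightarrow> 'b \<Rightarrow> 'z) \<Rightarrow>
    ('s, 'a \<times> 'b) over \<Rightarrow> (('y \<times> 'b) \<times> 's, 'y \<times> 'z) over" where
  "feedback Y B w v M =
     over_postcomp (\<lambda>l (y, x). (y, v l x))
       (over_pullback (sheaf_prod Y B) (\<lambda>l (y, x). (w l (y, x), x)) M)"

lemma state_feedback:
  "state (feedback Y B w v M) =
    pullback (sheaf_prod Y B) (\<lambda>l (y, x). (w l (y, x), x)) (state M) (ports M)"
  by (simp add: feedback_def over_postcomp_def over_pullback_def)

lemma sec_feedback:
  "((y, x), s) \<in> sec (state (feedback Y B w v M)) l \<longleftrightarrow>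
    y \<in> sec Y l \<and> x \<in> sec B l \<and> s \<in> sec (state M) l \<and>
    in_port M l s = w l (y, x) \<and> out_port M l s = x"
  by (auto simp: state_feedback sec_pullback sec_sheaf_prod in_port_def out_port_def prod_eq_iff)

lemma restr_feedback:
  "restr (state (feedback Y B w v M)) l p l' ((y, x), s) =
    ((restr Y l p l' y, restr B l p l' x), restr (state M) l p l' s)"
  by (simp add: state_feedback restr_pullback restr_sheaf_prod)

lemma in_port_feedback: "in_port (feedback Y B w v M) = (\<lambda>l z. fst (fst z))"
  by (auto simp: in_port_def feedback_def over_postcomp_def over_pullback_def comp_map_def
      split_beta fun_eq_iff)

lemma out_port_feedback: "out_port (feedback Y B w v M) = (\<lambda>l z. v l (snd (fst z)))"
  by (auto simp: out_port_def feedback_def over_postcomp_def over_pullback_def comp_map_def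
      split_beta fun_eq_iff)

lemma sheaf_map_feedback_state: "sheaf_map (state (feedback Y B w v M)) (state M) (\<lambda>l. snd)"
  unfolding state_feedback by (rule sheaf_map_pullback_snd)

lemma machine_feedback:
  assumes A: "sheaf A" and B: "sheaf B" and Y: "sheaf Y" and M: "machine A B M"
    and w: "sheaf_map (sheaf_prod Y B) A w" and v: "sheaf_map B Z v"
  shows "machine Y Z (feedback Y B w v M)"
  unfolding machine_iff in_port_feedback out_port_feedback
proof (intro conjI)
  have w': "sheaf_map (sheaf_prod Y B) (sheaf_prod A B) (\<lambda>l (y, x). (w l (y, x), x))"
    using sheaf_map_into_prod[OF w sheaf_map_prod_snd] by (simp add: case_prod_unfold)
  show "sheaf (state (feedback Y B w v M))"
    unfolding state_feedback
    by (rule sheaf_pullback[OF sheaf_sheaf_prod[OF Y B] _ sheaf_sheaf_prod[OF A B] w'])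
      (use M in \<open>simp_all add: machine_def over_obj_def\<close>)
  have f: "sheaf_map (state (feedback Y B w v M)) (sheaf_prod Y B) (\<lambda>l. fst)"
    unfolding state_feedback by (rule sheaf_map_pullback_fst)
  show "sheaf_map (state (feedback Y B w v M)) Y (\<lambda>l z. fst (fst z))"
    by (rule sheaf_map_comp[OF f sheaf_map_prod_fst])
  show "sheaf_map (state (feedback Y B w v M)) Z (\<lambda>l z. v l (snd (fst z)))"
    by (rule sheaf_map_comp[OF sheaf_map_comp[OF f sheaf_map_prod_snd] v])
qed

lemma inertial_feedback:
  assumes p: "inertial_map (state M) B (out_port M)" and v: "sheaf_map B Z v"
  shows "inertial_map (state (feedback Y B w v M)) Z (out_port (feedback Y B w v M))"
proof -
  let ?F = "feedback Y B w v M"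
  have "inertial_map (state ?F) Z (\<lambda>l z. v l (out_port M l (snd z)))"
    by (rule inertial_map_precomp[OF inertial_map_postcomp[OF p v] sheaf_map_feedback_state])
  moreover have "map_eq (state ?F) (out_port ?F) (\<lambda>l z. v l (out_port M l (snd z)))"
    by (auto simp: map_eq_def out_port_feedback sec_feedback)
  ultimately show ?thesis unfolding inertial_map_def map_eq_def by simp
qed

text \<open>
  The output over \<open>[0, e]\<close> is forced by the initial state; together with the outer input it
  determines the inner input, which totality of the inner machine lifts to a run of states.
\<close>

lemma lifts_feedback:
  assumes A: "sheaf A" and B: "sheaf B" and Y: "sheaf Y" and M: "machine A B M"
    and w: "sheaf_map (sheaf_prod Y B) A w"
    and q: "sheaf_map (state M) (Ext d B) q"
    and pq: "map_eq (state M) (out_port M) (comp_map (left_restr d B) q)"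
    and e: "0 < e" "e \<le> d" and L: "lifts (state M) A (in_port M) e"
  shows "lifts (state (feedback Y B w v M)) Y (in_port (feedback Y B w v M)) e"
  unfolding lifts_def
proof (intro ballI impI)
  let ?F = "feedback Y B w v M"
  note pB = presheafD[OF sheaf_presheaf[OF B]]
  have S: "presheaf (state M)" and po: "sheaf_map (state M) B (out_port M)"
    using M by (auto simp: machine_iff sheaf_presheaf)
  have h: "int_hom 0 e 0" "int_hom e d 0" "int_hom 0 0 0" "0 \<le> e" using e by (auto simp: int_hom_def)
  fix y z assume y: "y \<in> sec Y e" and z: "z \<in> sec (state ?F) 0"
    and yz: "restr Y e 0 0 y = in_port ?F 0 z"
  obtain s0 where zs: "z = ((restr Y e 0 0 y, out_port M 0 s0), s0)" and s0: "s0 \<in> sec (state M) 0"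
    and i0: "in_port M 0 s0 = w 0 (restr Y e 0 0 y, out_port M 0 s0)"
    using z yz by (cases z; cases "fst z") (auto simp: sec_feedback in_port_feedback)
  \<comment> \<open>The output that every run starting at \<open>s0\<close> must produce over \<open>[0, e]\<close>.\<close>
  define x where "x = restr B d 0 e (q 0 s0)"
  have q0: "q 0 s0 \<in> sec B d" using sheaf_mapD(1)[OF q _ s0] by (simp add: Ext_def)
  have x: "x \<in> sec B e" unfolding x_def by (rule pB(1)[OF h(2) q0])
  have x0: "restr B e 0 0 x = out_port M 0 s0"
    using inertial_determined[OF S sheaf_presheaf[OF B] q pq order_refl _ s0] e
      pB(3)[OF h(2,1) q0] presheafD(2)[OF S order_refl s0] by (simp add: x_def)
  have yx: "(y, x) \<in> sec (sheaf_prod Y B) e" using x y by (simp add: sec_sheaf_prod)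
  have "restr A e 0 0 (w e (y, x)) = in_port M 0 s0"
    using sheaf_mapD(2)[OF w h(1) yx] by (simp add: restr_sheaf_prod x0 i0)
  then obtain s where s: "s \<in> sec (state M) e" "in_port M e s = w e (y, x)"
    "restr (state M) e 0 0 s = s0"
    using L sheaf_mapD(1)[OF w h(4) yx] s0 unfolding lifts_def by blast
  have "out_port M e s = x"
    using inertial_determined[OF S sheaf_presheaf[OF B] q pq h(4) e(2) s(1)] s(3)
    by (simp add: x_def)
  with s x y have "((y, x), s) \<in> sec (state ?F) e" by (simp add: sec_feedback)
  moreover have "restr (state ?F) e 0 0 ((y, x), s) = z"
    by (simp add: restr_feedback x0 s(3) zs)
  ultimately show "\<exists>t\<in>sec (state ?F) e. in_port ?F e t = y \<and> restr (state ?F) e 0 0 t = z"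
    by (intro bexI[of _ "((y, x), s)"]) (auto simp: in_port_feedback)
qed

lemma lifts_unique_feedback:
  assumes B: "sheaf B" and M: "machine A B M"
    and q: "sheaf_map (state M) (Ext d B) q"
    and pq: "map_eq (state M) (out_port M) (comp_map (left_restr d B) q)"
    and e: "0 < e" "e \<le> d" and L: "lifts_unique (state M) (in_port M) e"
  shows "lifts_unique (state (feedback Y B w v M)) (in_port (feedback Y B w v M)) e"
  unfolding lifts_unique_def
proof (intro ballI impI)
  let ?F = "feedback Y B w v M"
  have S: "presheaf (state M)" using M by (auto simp: machine_iff sheaf_presheaf)
  fix z z' assume z: "z \<in> sec (state ?F) e" "z' \<in> sec (state ?F) e"
    and i: "in_port ?F e z = in_port ?F e z'"
    and r: "restr (state ?F) e 0 0 z = restr (state ?F) e 0 0 z'"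
  obtain y x s y' x' s' where zz: "z = ((y, x), s)" "z' = ((y', x'), s')" by (metis surj_pair)
  have s: "s \<in> sec (state M) e" "s' \<in> sec (state M) e"
    and p: "in_port M e s = w e (y, x)" "in_port M e s' = w e (y', x')"
    and o: "out_port M e s = x" "out_port M e s' = x'"
    and y: "y = y'" and rs: "restr (state M) e 0 0 s = restr (state M) e 0 0 s'"
    using z i r by (auto simp: zz sec_feedback in_port_feedback restr_feedback)
  have x: "x = x'"
    using inertial_determined[OF S sheaf_presheaf[OF B] q pq _ e(2)] s o rs e(1) by force
  then have "in_port M e s = in_port M e s'" using p y by simp
  then have "s = s'" using L s rs unfolding lifts_unique_def by blast
  then show "z = z'" using x y zz by simp
qed

lemma total_machine_feedback:
  assumes A: "sheaf A" and B: "sheaf B" and Y: "sheaf Y" and M: "total_machine A B M"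
    and w: "sheaf_map (sheaf_prod Y B) A w" and v: "sheaf_map B Z v"
  shows "total_machine Y Z (feedback Y B w v M)"
proof -
  let ?F = "feedback Y B w v M"
  have m: "machine A B M" and t: "total_map (state M) A (in_port M)"
    and o: "inertial_map (state M) B (out_port M)" using M by (auto simp: total_machine_def)
  have F: "machine Y Z ?F" by (rule machine_feedback[OF A B Y m w v])
  obtain d q where d: "0 < d" and q: "sheaf_map (state M) (Ext d B) q"
    "map_eq (state M) (out_port M) (comp_map (left_restr d B) q)"
    using o unfolding inertial_map_def by blast
  have L: "lifts (state M) A (in_port M) e" if "0 < e" for e
    using t total_map_iff_lifts[of "state M" A "in_port M"] m A that by (simp add: machine_iff)
  have "total_map (state ?F) Y (in_port ?F)"
    using F by (intro total_mapI_short[OF _ Y _ d] lifts_feedback[OF A B Y m w q] L)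
      (auto simp: machine_iff)
  then show ?thesis using F inertial_feedback[OF o v] unfolding total_machine_def by blast
qed

lemma deterministic_machine_feedback:
  assumes A: "sheaf A" and B: "sheaf B" and Y: "sheaf Y" and M: "deterministic_machine A B M"
    and w: "sheaf_map (sheaf_prod Y B) A w" and v: "sheaf_map B Z v"
  shows "deterministic_machine Y Z (feedback Y B w v M)"
proof -
  let ?F = "feedback Y B w v M"
  have m: "machine A B M" and t: "deterministic_map (state M) A (in_port M)"
    and o: "inertial_map (state M) B (out_port M)" using M by (auto simp: deterministic_machine_def)
  have F: "machine Y Z ?F" by (rule machine_feedback[OF A B Y m w v])
  obtain d q where d: "0 < d" and q: "sheaf_map (state M) (Ext d B) q"
    "map_eq (state M) (out_port M) (comp_map (left_restr d B) q)"
    using o unfolding inertial_map_def by blast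
  have L: "lifts_unique (state M) (in_port M) e" if "0 < e" for e
    using t deterministic_map_iff_lifts_unique[of "state M" A "in_port M"] m A that
    by (simp add: machine_iff)
  have "deterministic_map (state ?F) Y (in_port ?F)"
    using F by (intro deterministic_mapI_short[OF _ Y _ d] lifts_unique_feedback[OF B m q] L)
      (auto simp: machine_iff)
  then show ?thesis using F inertial_feedback[OF o v] unfolding deterministic_machine_def by blast
qed


section \<open>Machines in parallel\<close>

text \<open>
  \<open>j\<close> and \<open>k\<close> combine the ports of the two machines. When \<open>j\<close> is an isomorphism of sheaves,
  lifting problems of the combined machine are pairs of lifting problems.
\<close>

definition parallel ::
  "(real \<Rightarrow> 'a \<times> 'b \<Rightarrow> 'c) \<Rightarrow> (real \<Rightarrow> 'x \<times> 'y \<Rightarrow> 'z) \<Rightarrow> ('s, 'a \<times> 'x) over \<Rightarrow>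
    ('t, 'b \<times> 'y) over \<Rightarrow> ('s \<times> 't, 'c \<times> 'z) over" where
  "parallel j k M N = \<lparr> state = sheaf_prod (state M) (state N),
     ports = (\<lambda>l (s, t). (j l (in_port M l s, in_port N l t), k l (out_port M l s, out_port N l t))) \<rparr>"

lemma state_parallel: "state (parallel j k M N) = sheaf_prod (state M) (state N)"
  by (simp add: parallel_def)

lemma in_port_parallel:
  "in_port (parallel j k M N) = (\<lambda>l z. j l (in_port M l (fst z), in_port N l (snd z)))"
  by (simp add: parallel_def in_port_def split_beta fun_eq_iff)

lemma out_port_parallel:
  "out_port (parallel j k M N) = (\<lambda>l z. k l (out_port M l (fst z), out_port N l (snd z)))"
  by (simp add: parallel_def out_port_def split_beta fun_eq_iff)

lemma sheaf_map_prod_map: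
  assumes "sheaf_map S A f" "sheaf_map T B g"
  shows "sheaf_map (sheaf_prod S T) (sheaf_prod A B) (\<lambda>l z. (f l (fst z), g l (snd z)))"
  by (intro sheaf_map_into_prod sheaf_map_comp[OF sheaf_map_prod_fst assms(1)]
      sheaf_map_comp[OF sheaf_map_prod_snd assms(2)])

lemma machine_parallel:
  assumes M: "machine A X M" and N: "machine B Y N"
    and j: "sheaf_map (sheaf_prod A B) C j" and k: "sheaf_map (sheaf_prod X Y) Z k"
  shows "machine C Z (parallel j k M N)"
  unfolding machine_iff state_parallel in_port_parallel out_port_parallel
  by (intro conjI sheaf_sheaf_prod sheaf_map_comp[OF sheaf_map_prod_map j]
      sheaf_map_comp[OF sheaf_map_prod_map k]) (use M N in \<open>simp_all add: machine_iff\<close>)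

lemma inertial_parallel:
  assumes X: "presheaf X" and Y: "presheaf Y" and k: "sheaf_map (sheaf_prod X Y) Z k"
    and M: "inertial_map (state M) X (out_port M)" and N: "inertial_map (state N) Y (out_port N)"
  shows "inertial_map (state (parallel j k M N)) Z (out_port (parallel j k M N))"
  unfolding state_parallel out_port_parallel
  by (intro inertial_map_postcomp[OF _ k] inertial_map_prod[OF X Y]
      inertial_map_precomp[OF M sheaf_map_prod_fst] inertial_map_precomp[OF N sheaf_map_prod_snd])

lemma lifts_parallel:
  assumes M: "machine A X M" and N: "machine B Y N" and A: "presheaf A" and B: "presheaf B"
    and j: "sheaf_map (sheaf_prod A B) C j"
    and bij: "\<And>l. 0 \<le> l \<Longrightarrow> bij_betw (j l) (sec (sheaf_prod A B) l) (sec C l)"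
    and e: "0 \<le> e" and L: "lifts (state M) A (in_port M) e" "lifts (state N) B (in_port N) e"
  shows "lifts (state (parallel j k M N)) C (in_port (parallel j k M N)) e"
  unfolding lifts_def
proof (intro ballI impI)
  let ?P = "parallel j k M N"
  have h: "int_hom 0 e 0" using e by (simp add: int_hom_def)
  fix c z assume c: "c \<in> sec C e" and z: "z \<in> sec (state ?P) 0"
    and eq: "restr C e 0 0 c = in_port ?P 0 z"
  obtain s t where zs: "z = (s, t)" "s \<in> sec (state M) 0" "t \<in> sec (state N) 0"
    using z by (cases z) (auto simp: state_parallel sec_sheaf_prod)
  obtain a b where ab: "c = j e (a, b)" "(a, b) \<in> sec (sheaf_prod A B) e"
    using bij_betw_imp_surj_on[OF bij[OF e]] c by fastforce
  then have ab': "a \<in> sec A e" "b \<in> sec B e" by (auto simp: sec_sheaf_prod)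
  have "j 0 (restr A e 0 0 a, restr B e 0 0 b) = j 0 (in_port M 0 s, in_port N 0 t)"
    using eq sheaf_mapD(2)[OF j h ab(2)]
    by (simp add: ab(1) in_port_parallel zs(1) restr_sheaf_prod)
  moreover have "in_port M 0 s \<in> sec A 0" "in_port N 0 t \<in> sec B 0"
    using M N zs sheaf_mapD(1)[of "state M" A "in_port M"] sheaf_mapD(1)[of "state N" B "in_port N"]
    by (auto simp: machine_iff)
  ultimately have "restr A e 0 0 a = in_port M 0 s" "restr B e 0 0 b = in_port N 0 t"
    using inj_onD[OF bij_betw_imp_inj_on[OF bij[OF order_refl]]]
      presheafD(1)[OF A h ab'(1)] presheafD(1)[OF B h ab'(2)] by (auto simp: sec_sheaf_prod)
  then obtain s' t' where "s' \<in> sec (state M) e" "in_port M e s' = a" "restr (state M) e 0 0 s' = s"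
    "t' \<in> sec (state N) e" "in_port N e t' = b" "restr (state N) e 0 0 t' = t"
    using L ab' zs(2,3) unfolding lifts_def by blast
  then show "\<exists>u\<in>sec (state ?P) e. in_port ?P e u = c \<and> restr (state ?P) e 0 0 u = z"
    by (intro bexI[of _ "(s', t')"])
      (auto simp: state_parallel in_port_parallel sec_sheaf_prod restr_sheaf_prod ab(1) zs(1))
qed

lemma lifts_unique_parallel:
  assumes M: "machine A X M" and N: "machine B Y N"
    and inj: "inj_on (j e) (sec (sheaf_prod A B) e)"
    and e: "0 \<le> e" and L: "lifts_unique (state M) (in_port M) e" "lifts_unique (state N) (in_port N) e"
  shows "lifts_unique (state (parallel j k M N)) (in_port (parallel j k M N)) e"
  unfolding lifts_unique_def
proof (intro ballI impI)
  let ?P = "parallel j k M N"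
  fix z z' assume z: "z \<in> sec (state ?P) e" "z' \<in> sec (state ?P) e"
    and i: "in_port ?P e z = in_port ?P e z'"
    and r: "restr (state ?P) e 0 0 z = restr (state ?P) e 0 0 z'"
  obtain s t s' t' where zz: "z = (s, t)" "z' = (s', t')" by (metis surj_pair)
  have st: "s \<in> sec (state M) e" "t \<in> sec (state N) e" "s' \<in> sec (state M) e" "t' \<in> sec (state N) e"
    and rs: "restr (state M) e 0 0 s = restr (state M) e 0 0 s'"
      "restr (state N) e 0 0 t = restr (state N) e 0 0 t'"
    and ij: "j e (in_port M e s, in_port N e t) = j e (in_port M e s', in_port N e t')"
    using z i r by (auto simp: zz state_parallel in_port_parallel sec_sheaf_prod restr_sheaf_prod)
  have "(in_port M e s, in_port N e t) \<in> sec (sheaf_prod A B) e"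
    "(in_port M e s', in_port N e t') \<in> sec (sheaf_prod A B) e"
    using M N st e sheaf_mapD(1)[of "state M" A "in_port M"] sheaf_mapD(1)[of "state N" B "in_port N"]
    by (auto simp: machine_iff sec_sheaf_prod)
  from inj_onD[OF inj ij this] show "z = z'"
    using L st rs unfolding lifts_unique_def zz by blast
qed

lemma total_machine_parallel:
  assumes M: "total_machine A X M" and N: "total_machine B Y N"
    and A: "sheaf A" and B: "sheaf B" and C: "sheaf C" and X: "sheaf X" and Y: "sheaf Y"
    and j: "sheaf_map (sheaf_prod A B) C j" and k: "sheaf_map (sheaf_prod X Y) Z k"
    and bij: "\<And>l. 0 \<le> l \<Longrightarrow> bij_betw (j l) (sec (sheaf_prod A B) l) (sec C l)"
  shows "total_machine C Z (parallel j k M N)"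
proof -
  let ?P = "parallel j k M N"
  have m: "machine A X M" "machine B Y N"
    and t: "total_map (state M) A (in_port M)" "total_map (state N) B (in_port N)"
    and o: "inertial_map (state M) X (out_port M)" "inertial_map (state N) Y (out_port N)"
    using M N by (auto simp: total_machine_def)
  have P: "machine C Z ?P" by (rule machine_parallel[OF m j k])
  have "lifts (state M) A (in_port M) e" "lifts (state N) B (in_port N) e" if "0 < e" for e
    using t total_map_iff_lifts[of "state M" A "in_port M"]
      total_map_iff_lifts[of "state N" B "in_port N"] m A B that by (auto simp: machine_iff)
  then have "lifts (state ?P) C (in_port ?P) e" if "0 < e" for e
    using that
    by (intro lifts_parallel[OF m sheaf_presheaf[OF A] sheaf_presheaf[OF B] j bij]) auto
  then have "total_map (state ?P) C (in_port ?P)"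
    using P total_map_iff_lifts[of "state ?P" C "in_port ?P"] C by (simp add: machine_iff)
  then show ?thesis
    using P inertial_parallel[OF sheaf_presheaf[OF X] sheaf_presheaf[OF Y] k o]
    unfolding total_machine_def by blast
qed

lemma deterministic_machine_parallel:
  assumes M: "deterministic_machine A X M" and N: "deterministic_machine B Y N"
    and A: "sheaf A" and B: "sheaf B" and C: "sheaf C" and X: "sheaf X" and Y: "sheaf Y"
    and j: "sheaf_map (sheaf_prod A B) C j" and k: "sheaf_map (sheaf_prod X Y) Z k"
    and inj: "\<And>l. 0 \<le> l \<Longrightarrow> inj_on (j l) (sec (sheaf_prod A B) l)"
  shows "deterministic_machine C Z (parallel j k M N)"
proof -
  let ?P = "parallel j k M N"
  have m: "machine A X M" "machine B Y N"
    and t: "deterministic_map (state M) A (in_port M)" "deterministic_map (state N) B (in_port N)"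
    and o: "inertial_map (state M) X (out_port M)" "inertial_map (state N) Y (out_port N)"
    using M N by (auto simp: deterministic_machine_def)
  have P: "machine C Z ?P" by (rule machine_parallel[OF m j k])
  have "lifts_unique (state M) (in_port M) e" "lifts_unique (state N) (in_port N) e"
    if "0 < e" for e
    using t deterministic_map_iff_lifts_unique[of "state M" A "in_port M"]
      deterministic_map_iff_lifts_unique[of "state N" B "in_port N"] m A B that
    by (auto simp: machine_iff)
  then have "lifts_unique (state ?P) (in_port ?P) e" if "0 < e" for e
    using that by (intro lifts_unique_parallel[OF m inj]) auto
  then have "deterministic_map (state ?P) C (in_port ?P)"
    using P deterministic_map_iff_lifts_unique[of "state ?P" C "in_port ?P"] C
    by (simp add: machine_iff)
  then show ?thesis
    using P inertial_parallel[OF sheaf_presheaf[OF X] sheaf_presheaf[OF Y] k o]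
    unfolding deterministic_machine_def by blast
qed


section \<open>Products over the wires of a box\<close>

lemma sec_hat: "sec (hat X) l = (\<Pi>\<^sub>E i\<in>wires X. sec (wtyp X i) l)"
  by (simp add: hat_def)

lemma restr_hat: "restr (hat X) l p l' x = (\<lambda>i\<in>wires X. restr (wtyp X i) l p l' (x i))"
  by (simp add: hat_def)

lemma sheaf_hat:
  assumes "\<And>i. i \<in> wires X \<Longrightarrow> sheaf (wtyp X i)"
  shows "sheaf (hat X)"
proof (rule sheafI)
  have W: "presheaf (wtyp X i)" if "i \<in> wires X" for i using assms[OF that] by (rule sheaf_presheaf)
  have m: "x i \<in> sec (wtyp X i) l" if "x \<in> sec (hat X) l" "i \<in> wires X" for x l i
    using that by (auto simp: sec_hat)
  show "presheaf (hat X)"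
    unfolding presheaf_def
  proof (intro conjI allI impI)
    fix l p l' x assume "int_hom l' l p" "x \<in> sec (hat X) l"
    then have "\<forall>i\<in>wires X. restr (wtyp X i) l p l' (x i) \<in> sec (wtyp X i) l'"
      by (simp add: presheafD(1)[OF W] m)
    then show "restr (hat X) l p l' x \<in> sec (hat X) l'" by (simp add: sec_hat restr_hat)
  next
    fix l x assume "0 \<le> l" and x: "x \<in> sec (hat X) l"
    then have "(\<lambda>i\<in>wires X. restr (wtyp X i) l 0 l (x i)) = restrict x (wires X)"
      by (intro restrict_ext) (simp add: presheafD(2)[OF W] m)
    then show "restr (hat X) l 0 l x = x" using x by (simp add: restr_hat sec_hat PiE_restrict)
  next
    fix l p l' p' l'' x assume "int_hom l' l p" "int_hom l'' l' p'" and x: "x \<in> sec (hat X) l"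
    then show "restr (hat X) l' p' l'' (restr (hat X) l p l' x) = restr (hat X) l (p + p') l'' x"
      unfolding restr_hat by (intro restrict_ext) (simp add: presheafD(3)[OF W] m)
  qed
  fix l1 l2 :: real assume l: "0 \<le> l1" "0 \<le> l2"
  {
    fix x1 x2 assume x: "x1 \<in> sec (hat X) l1" "x2 \<in> sec (hat X) l2"
      and eq: "restr (hat X) l1 l1 0 x1 = restr (hat X) l2 0 0 x2"
    have "\<exists>y\<in>sec (wtyp X i) (l1 + l2). restr (wtyp X i) (l1 + l2) 0 l1 y = x1 i \<and>
        restr (wtyp X i) (l1 + l2) l1 l2 y = x2 i" if i: "i \<in> wires X" for i
    proof -
      have "restr (wtyp X i) l1 l1 0 (x1 i) = restr (wtyp X i) l2 0 0 (x2 i)"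
        using fun_cong[OF eq, of i] i by (simp add: restr_hat)
      then show ?thesis
        using sheaf_glue[OF assms[OF i] l, of "x1 i" "x2 i"] x i by (metis PiE_mem sec_hat)
    qed
    then obtain y where y: "\<And>i. i \<in> wires X \<Longrightarrow> y i \<in> sec (wtyp X i) (l1 + l2) \<and>
        restr (wtyp X i) (l1 + l2) 0 l1 (y i) = x1 i \<and> restr (wtyp X i) (l1 + l2) l1 l2 (y i) = x2 i"
      by metis
    have "restr (hat X) (l1 + l2) 0 l1 (restrict y (wires X)) = restrict x1 (wires X)"
      "restr (hat X) (l1 + l2) l1 l2 (restrict y (wires X)) = restrict x2 (wires X)"
      unfolding restr_hat using y by (auto intro!: restrict_ext)
    then show "\<exists>x\<in>sec (hat X) (l1 + l2). restr (hat X) (l1 + l2) 0 l1 x = x1 \<and>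
        restr (hat X) (l1 + l2) l1 l2 x = x2"
      using x y by (intro bexI[of _ "restrict y (wires X)"]) (auto simp: sec_hat PiE_restrict)
  next
    fix x y assume x: "x \<in> sec (hat X) (l1 + l2)" and y: "y \<in> sec (hat X) (l1 + l2)"
      and e1: "restr (hat X) (l1 + l2) 0 l1 x = restr (hat X) (l1 + l2) 0 l1 y"
      and e2: "restr (hat X) (l1 + l2) l1 l2 x = restr (hat X) (l1 + l2) l1 l2 y"
    show "x = y"
    proof (rule PiE_ext[OF x[unfolded sec_hat] y[unfolded sec_hat]])
      fix i assume i: "i \<in> wires X"
      show "x i = y i"
        by (rule sheaf_separated[OF assms[OF i] l])
          (use x y i fun_cong[OF e1, of i] fun_cong[OF e2, of i] in
            \<open>auto simp: sec_hat restr_hat PiE_mem\<close>)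
    qed
  }
qed

lemma sheaf_map_hat_map:
  assumes f: "typed_fun X X' f"
  shows "sheaf_map (hat X') (hat X) (hat_map X f)"
proof -
  have w: "f i \<in> wires X'" "wtyp X' (f i) = wtyp X i" if "i \<in> wires X" for i
    using f that by (auto simp: typed_fun_def)
  show ?thesis
    unfolding sheaf_map_def
  proof (intro conjI allI impI)
    fix l x assume "x \<in> sec (hat X') l"
    then show "hat_map X f l x \<in> sec (hat X) l" using w by (auto simp: sec_hat hat_map_def PiE_iff) (metis w)
  next
    fix l p l' x assume "x \<in> sec (hat X') l"
    then show "hat_map X f l' (restr (hat X') l p l' x) = restr (hat X) l p l' (hat_map X f l x)"
      by (auto simp: hat_map_def restr_hat w intro!: restrict_ext)
  qed
qed

lemma sheaf_map_hat_join:
  "sheaf_map (sheaf_prod (hat X) (hat X')) (hat (typed_sum X X')) (hat_join X X')"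
  unfolding sheaf_map_def
  by (auto simp: sec_hat restr_hat sec_sheaf_prod restr_sheaf_prod hat_join_def typed_sum_def
      PiE_iff intro!: restrict_ext)

lemma bij_betw_hat_join:
  "bij_betw (hat_join X X' l) (sec (sheaf_prod (hat X) (hat X')) l) (sec (hat (typed_sum X X')) l)"
proof (rule bij_betw_byWitness[where f' = "\<lambda>z. (\<lambda>i\<in>wires X. z (Inl i), \<lambda>i\<in>wires X'. z (Inr i))"])
  show "\<forall>z\<in>sec (sheaf_prod (hat X) (hat X')) l.
      (\<lambda>i\<in>wires X. hat_join X X' l z (Inl i), \<lambda>i\<in>wires X'. hat_join X X' l z (Inr i)) = z"
    by (auto simp: sec_hat sec_sheaf_prod hat_join_def typed_sum_def fun_eq_iff PiE_iff
        extensional_def restrict_def)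
  show "\<forall>z\<in>sec (hat (typed_sum X X')) l.
      hat_join X X' l (\<lambda>i\<in>wires X. z (Inl i), \<lambda>i\<in>wires X'. z (Inr i)) = z"
    by (auto simp: sec_hat hat_join_def typed_sum_def fun_eq_iff PiE_iff
        extensional_def restrict_def split: sum.split)
  show "hat_join X X' l ` sec (sheaf_prod (hat X) (hat X')) l \<subseteq> sec (hat (typed_sum X X')) l"
    by (auto simp: sec_hat sec_sheaf_prod hat_join_def typed_sum_def PiE_iff)
  show "(\<lambda>z. (\<lambda>i\<in>wires X. z (Inl i), \<lambda>i\<in>wires X'. z (Inr i))) ` sec (hat (typed_sum X X')) l
      \<subseteq> sec (sheaf_prod (hat X) (hat X')) l"
    by (auto simp: sec_hat sec_sheaf_prod typed_sum_def PiE_iff Plus_def ball_Un)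
qed


lemma sheaf_map_win_hat:
  assumes "wiring_hom X Y \<phi>"
  shows "sheaf_map (sheaf_prod (hat (inp Y)) (hat (outp X))) (hat (inp X)) (win_hat X Y \<phi>)"
proof -
  have "sheaf_map (sheaf_prod (hat (inp Y)) (hat (outp X))) (hat (inp X))
      (\<lambda>l z. hat_map (inp X) (win \<phi>) l (hat_join (outp X) (inp Y) l (snd z, fst z)))"
    using assms unfolding wiring_hom_def
    by (intro sheaf_map_comp[OF sheaf_map_comp[OF
        sheaf_map_into_prod[OF sheaf_map_prod_snd sheaf_map_prod_fst] sheaf_map_hat_join]]
        sheaf_map_hat_map) simp
  then show ?thesis by (simp add: win_hat_def case_prod_unfold)
qed

lemma sheaf_map_wout_hat:
  "wiring_hom X Y \<phi> \<Longrightarrow> sheaf_map (hat (outp X)) (hat (outp Y)) (wout_hat Y \<phi>)"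
  unfolding wiring_hom_def wout_hat_def by (intro sheaf_map_hat_map) simp

lemma sheaf_hat_box:
  assumes "box_obj X"
  shows "sheaf (hat (inp X))" "sheaf (hat (outp X))"
  using assms by (auto simp: box_obj_def typed_finite_set_def intro: sheaf_hat)

lemma sheaf_hat_typed_sum:
  "typed_finite_set X \<Longrightarrow> typed_finite_set Y \<Longrightarrow> sheaf (hat (typed_sum X Y))"
  by (rule sheaf_hat) (auto simp: typed_finite_set_def typed_sum_def)


section \<open>Closure under the operations of the algebra\<close>

lemma Mch_wiring_feedback:
  "Mch_wiring X Y \<phi> M =
    feedback (hat (inp Y)) (hat (outp X)) (win_hat X Y \<phi>) (wout_hat Y \<phi>) M"
  by (simp add: Mch_wiring_def feedback_def)

lemma Mch_tensor_parallel:
  "Mch_tensor X Y M N =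
    parallel (hat_join (inp X) (inp Y)) (hat_join (outp X) (outp Y)) M N"
  by (simp add: Mch_tensor_def parallel_def)

lemma over_hom_feedback:
  assumes f: "over_hom M N f"
  shows "over_hom (feedback Y B w v M) (feedback Y B w v N) (Mch_wiring_map f)"
proof -
  have fm: "sheaf_map (state M) (state N) f" and fp: "map_eq (state M) (comp_map (ports N) f) (ports M)"
    using f by (auto simp: over_hom_def)
  have e: "Mch_wiring_map f = (\<lambda>l z. (fst z, f l (snd z)))"
    by (simp add: Mch_wiring_map_def case_prod_unfold)
  have "sheaf_map (state (feedback Y B w v M)) (state (feedback Y B w v N)) (Mch_wiring_map f)"
    unfolding e state_feedback
  proof (rule sheaf_map_into_pullback[OF sheaf_map_pullback_fst
        sheaf_map_comp[OF sheaf_map_pullback_snd fm]])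
    let ?h = "\<lambda>l (y, x). (w l (y, x), x)"
    fix l z assume "0 \<le> l" "z \<in> sec (pullback (sheaf_prod Y B) ?h (state M) (ports M)) l"
    then show "?h l (fst z) = ports N l (f l (snd z))"
      using fp by (cases z) (auto simp: sec_pullback map_eq_def comp_map_def)
  qed
  then show ?thesis
    unfolding over_hom_def
    by (simp add: e map_eq_def comp_map_def feedback_def over_postcomp_def over_pullback_def)
qed

lemma over_hom_parallel:
  assumes f: "over_hom M M' f" and g: "over_hom N N' g"
  shows "over_hom (parallel j k M N) (parallel j k M' N') (Mch_tensor_map f g)"
proof -
  have e: "Mch_tensor_map f g = (\<lambda>l z. (f l (fst z), g l (snd z)))"
    by (simp add: Mch_tensor_map_def case_prod_unfold)
  have "ports M' l (f l s) = ports M l s" if "0 \<le> l" "s \<in> sec (state M) l" for l s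
    using f that by (simp add: over_hom_def map_eq_def comp_map_def)
  moreover have "ports N' l (g l s) = ports N l s" if "0 \<le> l" "s \<in> sec (state N) l" for l s
    using g that by (simp add: over_hom_def map_eq_def comp_map_def)
  ultimately have "map_eq (state (parallel j k M N))
      (comp_map (ports (parallel j k M' N')) (Mch_tensor_map f g)) (ports (parallel j k M N))"
    by (auto simp: map_eq_def comp_map_def parallel_def e sec_sheaf_prod in_port_def out_port_def)
  moreover have "sheaf_map (state (parallel j k M N)) (state (parallel j k M' N')) (Mch_tensor_map f g)"
    using f g unfolding e state_parallel over_hom_def by (intro sheaf_map_prod_map) auto
  ultimately show ?thesis unfolding over_hom_def by blast
qed

lemma wiring_closed_total: "wiring_closed Mch_t Mch_t"
  unfolding wiring_closed_def Mch_t_def Mch_wiring_feedback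
  by (auto intro!: total_machine_feedback over_hom_feedback sheaf_hat_box sheaf_map_win_hat
      sheaf_map_wout_hat)

lemma wiring_closed_deterministic: "wiring_closed Mch_d Mch_d"
  unfolding wiring_closed_def Mch_d_def Mch_wiring_feedback
  by (auto intro!: deterministic_machine_feedback over_hom_feedback sheaf_hat_box
      sheaf_map_win_hat sheaf_map_wout_hat)

lemma tensor_closed_total: "tensor_closed Mch_t Mch_t Mch_t"
  unfolding tensor_closed_def Mch_t_def Mch_tensor_parallel box_sum_def
  by (auto intro!: total_machine_parallel over_hom_parallel sheaf_map_hat_join bij_betw_hat_join
      simp: sheaf_hat_box sheaf_hat_typed_sum box_obj_def)

lemma tensor_closed_deterministic: "tensor_closed Mch_d Mch_d Mch_d"
  unfolding tensor_closed_def Mch_d_def Mch_tensor_parallel box_sum_def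
  by (auto intro!: deterministic_machine_parallel over_hom_parallel sheaf_map_hat_join
      bij_betw_imp_inj_on[OF bij_betw_hat_join] simp: sheaf_hat_box sheaf_hat_typed_sum box_obj_def)

lemma hat_typed_empty:
  "sec (hat typed_empty) l = {\<lambda>i. undefined}" "restr (hat typed_empty) l p l' x = (\<lambda>i. undefined)"
  by (auto simp: sec_hat restr_hat typed_empty_def)

lemma sheaf_hat_typed_empty: "sheaf (hat typed_empty)"
  by (rule sheaf_hat) (simp add: typed_empty_def)

lemma Mch_unit_simps:
  "state Mch_unit = terminal_sheaf" "in_port Mch_unit = (\<lambda>l s i. undefined)"
  "out_port Mch_unit = (\<lambda>l s i. undefined)"
  by (auto simp: Mch_unit_def in_port_def out_port_def)

lemma sheaf_map_to_hat_empty: "sheaf_map A (hat typed_empty) (\<lambda>l x i. undefined)"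
  by (simp add: sheaf_map_def hat_typed_empty)

lemma machine_unit: "machine (hat typed_empty) (hat typed_empty) Mch_unit"
  unfolding machine_iff Mch_unit_simps by (intro conjI sheaf_terminal sheaf_map_to_hat_empty)

lemma inertial_to_hat_empty: "inertial_map A (hat typed_empty) (\<lambda>l x i. undefined)"
  unfolding inertial_map_def
proof (intro exI conjI)
  \<comment> \<open>All sections of the target coincide, so any positive delay works.\<close>
  show "sheaf_map A (Ext 1 (hat typed_empty)) (\<lambda>l x i. undefined)"
    by (simp add: sheaf_map_def Ext_def hat_typed_empty)
qed (auto simp: map_eq_def comp_map_def left_restr_def hat_typed_empty)

lemma total_map_unit: "total_map terminal_sheaf (hat typed_empty) (\<lambda>l x i. undefined)"
  unfolding total_map_iff_lifts[OF sheaf_terminal sheaf_hat_typed_empty sheaf_map_to_hat_empty]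
  by (simp add: lifts_def terminal_sheaf_def hat_typed_empty)

lemma deterministic_map_unit:
  "deterministic_map terminal_sheaf (hat typed_empty) (\<lambda>l x i. undefined)"
  unfolding deterministic_map_iff_lifts_unique[OF sheaf_terminal sheaf_hat_typed_empty
      sheaf_map_to_hat_empty]
  by (simp add: lifts_unique_def)

lemma unit_closed_total: "unit_closed Mch_t"
  by (simp add: unit_closed_def Mch_t_def total_machine_def box_zero_def machine_unit
      Mch_unit_simps total_map_unit inertial_to_hat_empty)

lemma unit_closed_deterministic: "unit_closed Mch_d"
  by (simp add: unit_closed_def Mch_d_def deterministic_machine_def box_zero_def machine_unit
      Mch_unit_simps deterministic_map_unit inertial_to_hat_empty)

theorem proposition4p3p2:
  shows "(wiring_closed Mch_t Mch_t \<and> tensor_closed Mch_t Mch_t Mch_t \<and> unit_closed Mch_t) \<and>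
    (wiring_closed Mch_d Mch_d \<and> tensor_closed Mch_d Mch_d Mch_d \<and> unit_closed Mch_d) \<and>
    (wiring_closed Mch_td Mch_td \<and> tensor_closed Mch_td Mch_td Mch_td \<and> unit_closed Mch_td)"
proof -
  have "wiring_closed Mch_td Mch_td"
    using wiring_closed_total wiring_closed_deterministic unfolding wiring_closed_def Mch_td_def
    by blast
  moreover have "tensor_closed Mch_td Mch_td Mch_td"
    using tensor_closed_total tensor_closed_deterministic unfolding tensor_closed_def Mch_td_def
    by blast
  moreover have "unit_closed Mch_td"
    using unit_closed_total unit_closed_deterministic unfolding unit_closed_def Mch_td_def by blast
  ultimately show ?thesis
    using wiring_closed_total wiring_closed_deterministic tensor_closed_total
      tensor_closed_deterministic unit_closed_total unit_closed_deterministic by blast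
qed

end
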